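(* Let $(\Omega,\mathcal F,\mathsf P)$ be a probability space and let $(X_n)_{n\in\mathbb N}$ be a sequence of i.i.d. random variables on it with $\mathsf E_{\mathsf P}[X_1]=0$ and $\sigma_{\mathsf P}^2:=\mathrm{Var}_{\mathsf P}[X_1]\in(0,\infty)$. Let $S_n:=\sum_{i=1}^nX_i$, $\overline{\mathsf U}^{(2)}_{\mathsf P}(x):=\mathsf E_{\mathsf P}[|X_1^2-\sigma_{\mathsf P}^2|\mathbf 1\{|X_1^2-\sigma_{\mathsf P}^2|\ge x\}]$ for $x\ge0$, and let $(\mathcal F_n)_{n\in\mathbb N_0}$ be the filtration generated by $(X_n)_{n\in\mathbb N}$. For $\varepsilon>0$ put $c_\varepsilon:=\big((1+\varepsilon)^{5/4}+(1+\varepsilon)^{3/4}\big)/\sqrt2$ and $\ell_\varepsilon:=\log\big(2\zeta(1+\varepsilon)/\log(1+\varepsilon)\big)$, where $\zeta(z):=\sum_{i=1}^\infty i^{-z}$ for $z>1$. For $j\in\mathbb N$ set $$m_j:=\min\left\{m\in\mathbb N\setminus\{1,2\}:\frac{2^{1+1/j}\,j\,\log_{1+1/j}^{-1/j}(2m/3)}{\zeta(1+1/j)}+\frac{262}{(\sigma_{\mathsf P}^4/j^2)\wedge1}\left(m^{-1/3}+\overline{\mathsf U}^{(2)}_{\mathsf P}(m^{1/3})\right)\le2^{-j}\right\},$$ and define $E_0^{(2)}:=0$ and, for $n\in\mathbb N$, $$E_n^{(2)}:=\sum_{j\in\mathbb N}\mathbf 1\left\{\text{there exists }k\in\{m_j,\ldots,n\}\text{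 such that }\frac{|S_k/\sigma_{\mathsf P}|}{c_{1/j}\sqrt{k[\log\log((1+1/j)^2k)+\ell_{1/j}]}}\ge1\right\}.$$ Then $(E_n^{(2)})_{n\in\mathbb N_0}$ is a $\mathsf P$-$e$-process, and $E_n^{(2)}(\omega)\to\infty$ as $n\to\infty$ for every $$\omega\in A_{\mathrm{fluc}}:=\left\{\limsup_{n\to\infty}\frac{|S_n/\sigma_{\mathsf P}|}{\sqrt{2n\log\log n}}>1\right\}.$$
   Context: $\mathbb N=\{1,2,\dots\}$, $\mathbb N_0=\{0,1,2,\dots\}$; $\{a,\dots,b\}$ is empty if $a>b$; $a\wedge b=\min(a,b)$. $\log$ is the natural logarithm; $\log_b^{-a}(x)$ means $(\log_bx)^{-a}$ with $\log_b$ the logarithm to base $b$. $e$-process: a nonnegative $(\mathcal F_n)_{n\in\mathbb N_0}$-adapted process $(E_n)_{n\in\mathbb N_0}$ is a $\mathsf P$-$e$-process if $\mathsf E_{\mathsf P}[E_\tau]\le1$ for every $(\mathcal F_n)_{n\in\mathbb N_0}$-stopping time $\tau$ (possibly taking the value $\infty$), with the convention $E_\infty=\limsup_nE_n$. *)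

theory Defs
  imports "HOL-Probability.Probability"
begin

text \<open>
  Sequences of random variables are functions on \<open>nat\<close>, of which only the values at indices
  \<open>1, 2, \<dots>\<close> are used.
\<close>

definition iid :: "'a measure \<Rightarrow> (nat \<Rightarrow> 'a \<Rightarrow> real) \<Rightarrow> bool" where
  "iid M X \<longleftrightarrow>
     prob_space.indep_vars M (\<lambda>_. borel) X {1..} \<and>
     (\<forall>i\<ge>1. distr M borel (X i) = distr M borel (X 1))"

definition generated_filtration :: "'a measure \<Rightarrow> (nat \<Rightarrow> 'a \<Rightarrow> real) \<Rightarrow> nat \<Rightarrow> 'a measure" where
  "generated_filtration M X n =
     sigma (space M) {X i -` B \<inter> space M | i B. i \<in> {1..n} \<and> B \<in> sets borel}"

text \<open>
  The library's \<^const>\<open>stopping_time\<close> takes its values in the index type of the filtration; here the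
  filtration is indexed by \<open>nat\<close> and the value \<open>\<infinity>\<close> is allowed.
\<close>

definition ext_stopping_time :: "'a measure \<Rightarrow> (nat \<Rightarrow> 'a measure) \<Rightarrow> ('a \<Rightarrow> enat) \<Rightarrow> bool" where
  "ext_stopping_time M F \<tau> \<longleftrightarrow> (\<forall>n. {\<omega> \<in> space M. \<tau> \<omega> \<le> enat n} \<in> sets (F n))"

definition stopped :: "(nat \<Rightarrow> 'a \<Rightarrow> ennreal) \<Rightarrow> ('a \<Rightarrow> enat) \<Rightarrow> 'a \<Rightarrow> ennreal" where
  "stopped E \<tau> \<omega> = (case \<tau> \<omega> of enat n \<Rightarrow> E n \<omega> | \<infinity> \<Rightarrow> limsup (\<lambda>n. E n \<omega>))"

text \<open>
  The process takes values in \<open>[0, \<infinity>)\<close>; the type \<^typ>\<open>ennreal\<close> is used because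
  the upper limit at \<open>\<tau> = \<infinity>\<close> may be infinite.
\<close>

definition e_process ::
    "'a measure \<Rightarrow> (nat \<Rightarrow> 'a measure) \<Rightarrow> (nat \<Rightarrow> 'a \<Rightarrow> ennreal) \<Rightarrow> bool" where
  "e_process M F E \<longleftrightarrow>
     filtration (space M) F \<and>
     (\<forall>n. subalgebra M (F n)) \<and>
     (\<forall>n. E n \<in> borel_measurable (F n)) \<and>
     (\<forall>n. \<forall>\<omega>\<in>space M. E n \<omega> < \<infinity>) \<and>
     (\<forall>\<tau>. ext_stopping_time M F \<tau> \<longrightarrow> (\<integral>\<^sup>+ \<omega>. stopped E \<tau> \<omega> \<partial>M) \<le> 1)"

definition partial_sum :: "(nat \<Rightarrow> 'a \<Rightarrow> real) \<Rightarrow> nat \<Rightarrow> 'a \<Rightarrow> real" where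
  "partial_sum X n \<omega> = (\<Sum>i=1..n. X i \<omega>)"

definition var1 :: "'a measure \<Rightarrow> (nat \<Rightarrow> 'a \<Rightarrow> real) \<Rightarrow> real" where
  "var1 M X = prob_space.variance M (X 1)"

definition sd1 :: "'a measure \<Rightarrow> (nat \<Rightarrow> 'a \<Rightarrow> real) \<Rightarrow> real" where
  "sd1 M X = sqrt (var1 M X)"

definition U2 :: "'a measure \<Rightarrow> (nat \<Rightarrow> 'a \<Rightarrow> real) \<Rightarrow> real \<Rightarrow> real" where
  "U2 M X x = prob_space.expectation M
     (\<lambda>\<omega>. \<bar>(X 1 \<omega>)\<^sup>2 - var1 M X\<bar> * of_bool (\<bar>(X 1 \<omega>)\<^sup>2 - var1 M X\<bar> \<ge> x))"

definition zeta_series :: "real \<Rightarrow> real" where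
  "zeta_series z = (\<Sum>i. real (Suc i) powr (- z))"

definition c_const :: "real \<Rightarrow> real" where
  "c_const \<epsilon> = ((1 + \<epsilon>) powr (5/4) + (1 + \<epsilon>) powr (3/4)) / sqrt 2"

definition l_const :: "real \<Rightarrow> real" where
  "l_const \<epsilon> = ln (2 * zeta_series (1 + \<epsilon>) / ln (1 + \<epsilon>))"

definition m_index :: "'a measure \<Rightarrow> (nat \<Rightarrow> 'a \<Rightarrow> real) \<Rightarrow> nat \<Rightarrow> nat" where
  "m_index M X j = (LEAST m. m \<ge> 3 \<and>
     2 powr (1 + 1 / real j) * real j * (log (1 + 1 / real j) (2 * real m / 3)) powr (- 1 / real j)
         / zeta_series (1 + 1 / real j)
     + 262 / min (sd1 M X ^ 4 / (real j)\<^sup>2) 1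
         * (real m powr (- 1 / 3) + U2 M X (real m powr (1 / 3)))
     \<le> 2 powr (- real j))"

definition crossing :: "'a measure \<Rightarrow> (nat \<Rightarrow> 'a \<Rightarrow> real) \<Rightarrow> nat \<Rightarrow> nat \<Rightarrow> 'a \<Rightarrow> bool" where
  "crossing M X j k \<omega> \<longleftrightarrow>
     \<bar>partial_sum X k \<omega> / sd1 M X\<bar>
       / (c_const (1 / real j)
          * sqrt (real k * (ln (ln ((1 + 1 / real j)\<^sup>2 * real k)) + l_const (1 / real j)))) \<ge> 1"

definition E2 :: "'a measure \<Rightarrow> (nat \<Rightarrow> 'a \<Rightarrow> real) \<Rightarrow> nat \<Rightarrow> 'a \<Rightarrow> ennreal" where
  "E2 M X n \<omega> =
     (if n = 0 then 0
      else \<Sum>\<^sub>\<infinity>j\<in>{1..}. of_bool (\<exists>k\<in>{m_index M X j..n}. crossing M X j k \<omega>))"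

text \<open>
  For \<open>n \<le> 2\<close> the quotient is meaningless, which does not affect the upper limit.
\<close>

definition A_fluc :: "'a measure \<Rightarrow> (nat \<Rightarrow> 'a \<Rightarrow> real) \<Rightarrow> 'a set" where
  "A_fluc M X = {\<omega> \<in> space M.
     limsup (\<lambda>n. ereal (\<bar>partial_sum X n \<omega> / sd1 M X\<bar> / sqrt (2 * real n * ln (ln (real n))))) > 1}"

end

theory Submission
  imports Defs "HOL-Real_Asymp.Real_Asymp"
begin

text \<open>
  The heart of the matter is that the \<open>j\<close>-th boundary, watched from time \<open>m\<close> on, is crossed with
  probability at most \<open>crossing_bound M X j m\<close> (lemma \<open>prob_crossing_le\<close>). Since
  \<open>m_index M X j\<close> is the first \<open>m \<ge> 3\<close> at which this bound is at most \<open>2 powr (- j)\<close>,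
  the expected number of boundaries that are ever crossed is at most \<open>\<Sum>j. 2 powr (- j) = 1\<close>;
  that number dominates the process at every stopping time, the value \<open>\<infinity>\<close> included.
  On the event of large fluctuations every boundary with large \<open>j\<close> is
  crossed after any given time, because \<open>c_const (1 / j)\<close> tends to \<open>sqrt 2\<close> and the
  boundary is asymptotic to \<open>c_const (1 / j) * sqrt (k * ln (ln k))\<close>.

  The bound on the crossing probability follows from a self-normalised argument. With
  \<open>R = X / \<sigma>\<close>, the inequality \<open>exp (u - u\<^sup>2 / 6) \<le> 1 + u + u\<^sup>2 / 3\<close> shows that
  \<open>exp (l * (\<Sum>R) - l\<^sup>2 / 2 * W)\<close> is a nonnegative supermartingale for every real \<open>l\<close>, where
  \<open>W\<^sub>k = (\<Sum>i=1..k. (R\<^sub>i\<^sup>2 + 2) / 3)\<close> serves as a random clock. Ville's inequality bounds the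
  probability that the walk ever lies above a fixed line in the variable \<open>W\<close>. Cutting the range of
  \<open>W\<close> into the epochs \<open>(1 + \<epsilon>) powr i \<le> W \<le> (1 + \<epsilon>) powr (i + 1)\<close>, with
  \<open>\<epsilon> = 1 / j\<close>, and placing under the boundary one line per epoch leaves probabilities
  proportional to \<open>(i + 1) powr (- (1 + \<epsilon>))\<close>, and \<open>zeta_series (1 + \<epsilon>)\<close> normalises them
  (lemma \<open>stitched_boundary_crossing\<close>). The clock is at least \<open>2 * k / 3\<close>, so only
  the epochs from \<open>log (1 + \<epsilon>) (2 * m / 3)\<close> on matter; their sum is at
  most the first summand of the bound.

  To translate the clock \<open>W\<^sub>k\<close> back to \<open>k\<close> one needs \<open>W\<^sub>k \<le> (1 + \<epsilon>) * k\<close> for all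
  \<open>k \<ge> m\<close>, which is a one-sided maximal law of large numbers for \<open>X\<^sup>2 - \<sigma>\<^sup>2\<close>.
  These variables are truncated at the level \<open>m powr (1 / 3)\<close>. The bounded part is handled by
  Hoeffding's lemma and Ville's inequality and yields the \<open>m powr (- 1 / 3)\<close>; the tail part has only a
  first moment and is handled by the maximal ergodic inequality (lemma
  \<open>iid_maximal_inequality\<close>), which yields \<open>U2\<close>. Together they stay
  below the second summand of the bound.
\<close>

section \<open>Ville's inequality for products of independent variables\<close>

text \<open>
  The logarithm of the right-hand side divided by the left-hand side has derivative
  \<open>u ^ 3 / (9 * (1 + u + u\<^sup>2 / 3))\<close>, whose sign is that of \<open>u\<close>, so its minimum is at \<open>0\<close>.
\<close>

lemma exp_sub_square_le:
  fixes u :: real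
  shows "exp (u - u\<^sup>2 / 6) \<le> 1 + u + u\<^sup>2 / 3"
proof -
  define D where "D = (\<lambda>u::real. 1 + u + u\<^sup>2 / 3)"
  define f where "f = (\<lambda>u::real. ln (D u) - u + u\<^sup>2 / 6)"
  have D_pos: "D t > 0" for t
  proof -
    have "D t = (t / 2 + 1)\<^sup>2 + t\<^sup>2 / 12"
      by (simp add: D_def power2_eq_square field_simps)
    moreover have "(t / 2 + 1)\<^sup>2 + t\<^sup>2 / 12 > 0"
      by (cases "t = 0") (auto intro: add_nonneg_pos)
    ultimately show ?thesis by simp
  qed
  have deriv: "(f has_real_derivative t ^ 3 / (9 * D t)) (at t)" for t
  proof -
    have "(f has_real_derivative (1 + 2 * t / 3) / D t - 1 + 2 * t / 6) (at t)"
      unfolding f_def using D_pos[of t]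
      by (auto intro!: derivative_eq_intros simp: D_def)
    also have "(1 + 2 * t / 3) / D t - 1 + 2 * t / 6 = t ^ 3 / (9 * D t)"
      using D_pos[of t] by (simp add: D_def field_simps power2_eq_square power3_eq_cube)
    finally show ?thesis .
  qed
  have "f 0 \<le> f u"
  proof (cases "u \<ge> 0")
    case True
    show ?thesis
      by (rule DERIV_nonneg_imp_nondecreasing[OF True])
        (use deriv D_pos in \<open>auto intro!: exI divide_nonneg_pos zero_le_power\<close>)
  next
    case False
    have "\<exists>y. (f has_real_derivative y) (at t) \<and> y \<le> 0" if "t \<le> 0" for t
    proof -
      have "t ^ 3 \<le> 0"
        using that by (simp add: power3_eq_cube mult_nonneg_nonpos)
      then have "t ^ 3 / (9 * D t) \<le> 0"
        using D_pos[of t] by (intro divide_nonpos_pos) auto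
      then show ?thesis
        using deriv by blast
    qed
    with False show ?thesis
      by (intro DERIV_nonpos_imp_nonincreasing[of u 0 f]) auto
  qed
  then have "u - u\<^sup>2 / 6 \<le> ln (D u)"
    by (simp add: f_def D_def)
  then show ?thesis
    using D_pos[of u] by (simp add: D_def ln_ge_iff)
qed

text \<open>
  The running product of \<open>x 1, x 2, \<dots>\<close>, stopped as soon as it reaches the level \<open>a\<close>: the
  optional stopping behind Ville's inequality becomes a plain recursion on the product.
\<close>

primrec frozen_product :: "real \<Rightarrow> (nat \<Rightarrow> real) \<Rightarrow> nat \<Rightarrow> real" where
  "frozen_product a x 0 = 1"
| "frozen_product a x (Suc n) =
     frozen_product a x n * (if frozen_product a x n < a then x (Suc n) else 1)"

lemma frozen_product_cong:
  "(\<And>i. i \<in> {1..n} \<Longrightarrow> x i = y i) \<Longrightarrow> frozen_product a x n = frozen_product a y n"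
  by (induction n) auto

lemma frozen_product_nonneg:
  "(\<And>i. i \<in> {1..n} \<Longrightarrow> 0 \<le> x i) \<Longrightarrow> 0 \<le> frozen_product a x n"
  by (induction n) auto

lemma frozen_product_measurable:
  "n \<le> m \<Longrightarrow> (\<lambda>x. frozen_product a x n) \<in> borel_measurable (PiM {1..m} (\<lambda>_. borel))"
proof (induction n)
  case (Suc n)
  then have [measurable]: "(\<lambda>x. frozen_product a x n) \<in> borel_measurable (PiM {1..m} (\<lambda>_. borel))"
    and "Suc n \<in> {1..m}" by auto
  from this(2) have [measurable]: "(\<lambda>x. x (Suc n)) \<in> borel_measurable (PiM {1..m} (\<lambda>_. borel))"
    by (rule measurable_component_singleton)
  show ?case unfolding frozen_product.simps by measurable
qed simp

lemma frozen_product_ge: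
  assumes "1 < a" "a \<le> (\<Prod>i=1..k. x i)" "k \<le> n"
  shows "a \<le> frozen_product a x n"
proof -
  have eq: "frozen_product a x n = (\<Prod>i=1..n. x i)" if "frozen_product a x n < a" for n
    using that by (induction n) (auto split: if_splits)
  have "a \<le> frozen_product a x k"
    using eq[of k] assms(2) by linarith
  then have "a \<le> frozen_product a x (k + d)" for d
    by (induction d) auto
  from this[of "n - k"] show ?thesis
    using assms(3) by simp
qed

context prob_space
begin

lemma prob_countable_increasing_le:
  assumes "\<And>n::nat. {\<omega> \<in> space M. P n \<omega>} \<in> events"
    and "\<And>m n \<omega>. m \<le> n \<Longrightarrow> P m \<omega> \<Longrightarrow> P n \<omega>"
    and "\<And>n. prob {\<omega> \<in> space M. P n \<omega>} \<le> c"
  shows "prob {\<omega> \<in> space M. \<exists>n. P n \<omega>} \<le> c"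
proof -
  have "incseq (\<lambda>n. {\<omega> \<in> space M. P n \<omega>})"
    using assms(2) by (auto simp: incseq_def)
  then have "(\<lambda>n. prob {\<omega> \<in> space M. P n \<omega>}) \<longlonglongrightarrow> prob (\<Union>n. {\<omega> \<in> space M. P n \<omega>})"
    using assms(1) by (intro finite_Lim_measure_incseq) auto
  then have "prob (\<Union>n. {\<omega> \<in> space M. P n \<omega>}) \<le> c"
    by (rule LIMSEQ_le_const2) (use assms(3) in auto)
  moreover have "(\<Union>n. {\<omega> \<in> space M. P n \<omega>}) = {\<omega> \<in> space M. \<exists>n. P n \<omega>}"
    by auto
  ultimately show ?thesis by simp
qed

text \<open>
  Ville's inequality. The expectation of the frozen product does not increase, since
  in each step the new factor either has mean at most \<open>1\<close> and is independent of the past or is replaced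
  by \<open>1\<close>. Markov's inequality applies to the frozen product, which has not come down again from
  the level \<open>a\<close> if the product reached it earlier.
\<close>

lemma ville_indep_product:
  fixes \<xi> :: "nat \<Rightarrow> 'a \<Rightarrow> real"
  assumes ind: "indep_vars (\<lambda>_. borel) \<xi> {1..}"
    and nonneg: "\<And>i \<omega>. 0 \<le> \<xi> i \<omega>"
    and mean: "\<And>i. 1 \<le> i \<Longrightarrow> (\<integral>\<^sup>+\<omega>. ennreal (\<xi> i \<omega>) \<partial>M) \<le> 1"
    and a: "0 < a"
  shows "prob {\<omega> \<in> space M. \<exists>n. a \<le> (\<Prod>i=1..n. \<xi> i \<omega>)} \<le> 1 / a"
proof (cases "1 < a")
  case False
  then have "1 \<le> 1 / a" using a by simp
  then show ?thesis using prob_le_1 order_trans by blast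
next
  case a1: True
  have [measurable]: "\<xi> i \<in> borel_measurable M" if "1 \<le> i" for i
    using ind that by (auto simp: indep_vars_def)
  define N where "N n \<omega> = frozen_product a (\<lambda>i. \<xi> i \<omega>) n" for n \<omega>
  have N_restrict: "N n \<omega> = frozen_product a (\<lambda>i\<in>{1..n}. \<xi> i \<omega>) n" for n \<omega>
    unfolding N_def by (rule frozen_product_cong) auto
  have [measurable]: "N n \<in> borel_measurable M" for n
  proof -
    have "(\<lambda>\<omega>. \<lambda>i\<in>{1..n}. \<xi> i \<omega>) \<in> measurable M (PiM {1..n} (\<lambda>_. borel))"
      by (rule measurable_restrict) simp
    from measurable_compose[OF this frozen_product_measurable[OF order_refl]]
    show ?thesis by (simp add: N_restrict[abs_def])
  qed
  have N_nonneg: "0 \<le> N n \<omega>" for n \<omega>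
    unfolding N_def by (rule frozen_product_nonneg) (rule nonneg)
  have step: "(\<integral>\<^sup>+\<omega>. ennreal (N (Suc n) \<omega>) \<partial>M) \<le> (\<integral>\<^sup>+\<omega>. ennreal (N n \<omega>) \<partial>M)" for n
  proof -
    (* g is the part of the product already frozen, h the part still moving. *)
    define g where "g x = (if frozen_product a x n < a then 0 else ennreal (frozen_product a x n))" for x
    define h where "h x = (if frozen_product a x n < a then ennreal (frozen_product a x n) else 0)" for x
    note [measurable] = frozen_product_measurable[OF order_refl, of a n]
    have [measurable]: "g \<in> borel_measurable (PiM {1..n} (\<lambda>_. borel))"
      "h \<in> borel_measurable (PiM {1..n} (\<lambda>_. borel))"
      unfolding g_def h_def by measurable
    define past where "past \<omega> = (\<lambda>i\<in>{1..n}. \<xi> i \<omega>)" for \<omega>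
    define nxt where "nxt \<omega> = (\<lambda>i\<in>{Suc n}. \<xi> i \<omega>)" for \<omega>
    have [measurable]: "past \<in> measurable M (PiM {1..n} (\<lambda>_. borel))"
      unfolding past_def by (rule measurable_restrict) simp
    have iv: "indep_var (PiM {1..n} (\<lambda>_. borel)) past (PiM {Suc n} (\<lambda>_. borel)) nxt"
      unfolding past_def nxt_def by (rule indep_var_restrict[OF ind]) auto
    have "indep_var borel (h \<circ> past) borel ((\<lambda>x. ennreal (x (Suc n))) \<circ> nxt)"
    proof (rule indep_var_compose[OF iv])
      show "h \<in> borel_measurable (PiM {1..n} (\<lambda>_. borel))" by measurable
      show "(\<lambda>x. ennreal (x (Suc n))) \<in> borel_measurable (PiM {Suc n} (\<lambda>_. borel))" by measurable
    qed
    then have iv2: "indep_vars (\<lambda>_. borel)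
        (case_bool (h \<circ> past) ((\<lambda>x. ennreal (x (Suc n))) \<circ> nxt)) UNIV"
      unfolding indep_var_def by (rule indep_vars_cong[THEN iffD1, rotated -1]) (auto split: bool.split)
    have "(\<integral>\<^sup>+\<omega>. h (past \<omega>) * ennreal (\<xi> (Suc n) \<omega>) \<partial>M)
        = (\<integral>\<^sup>+\<omega>. h (past \<omega>) \<partial>M) * (\<integral>\<^sup>+\<omega>. ennreal (\<xi> (Suc n) \<omega>) \<partial>M)"
      using indep_vars_nn_integral[OF _ iv2] by (simp add: UNIV_bool nxt_def mult.commute comp_def)
    also have "\<dots> \<le> (\<integral>\<^sup>+\<omega>. h (past \<omega>) \<partial>M) * 1"
      by (intro mult_left_mono mean) auto
    finally have le: "(\<integral>\<^sup>+\<omega>. h (past \<omega>) * ennreal (\<xi> (Suc n) \<omega>) \<partial>M) \<le> (\<integral>\<^sup>+\<omega>. h (past \<omega>) \<partial>M)"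
      by simp
    have "(\<integral>\<^sup>+\<omega>. ennreal (N (Suc n) \<omega>) \<partial>M)
        = (\<integral>\<^sup>+\<omega>. g (past \<omega>) + h (past \<omega>) * ennreal (\<xi> (Suc n) \<omega>) \<partial>M)"
    proof (rule nn_integral_cong)
      fix \<omega>
      have "N (Suc n) \<omega> = N n \<omega> * (if N n \<omega> < a then \<xi> (Suc n) \<omega> else 1)"
        by (simp add: N_def)
      then show "ennreal (N (Suc n) \<omega>) = g (past \<omega>) + h (past \<omega>) * ennreal (\<xi> (Suc n) \<omega>)"
        unfolding g_def h_def past_def N_restrict[symmetric]
        using N_nonneg[of n \<omega>] nonneg[of "Suc n" \<omega>] by (simp add: ennreal_mult)
    qed
    also have "\<dots> = (\<integral>\<^sup>+\<omega>. g (past \<omega>) \<partial>M) + (\<integral>\<^sup>+\<omega>. h (past \<omega>) * ennreal (\<xi> (Suc n) \<omega>) \<partial>M)"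
      by (rule nn_integral_add) auto
    also have "\<dots> \<le> (\<integral>\<^sup>+\<omega>. g (past \<omega>) \<partial>M) + (\<integral>\<^sup>+\<omega>. h (past \<omega>) \<partial>M)"
      by (intro add_left_mono le)
    also have "\<dots> = (\<integral>\<^sup>+\<omega>. g (past \<omega>) + h (past \<omega>) \<partial>M)"
      by (rule nn_integral_add[symmetric]) auto
    also have "\<dots> = (\<integral>\<^sup>+\<omega>. ennreal (N n \<omega>) \<partial>M)"
      by (intro nn_integral_cong) (auto simp: g_def h_def N_restrict past_def)
    finally show ?thesis .
  qed
  have N_le: "(\<integral>\<^sup>+\<omega>. ennreal (N n \<omega>) \<partial>M) \<le> 1" for n
  proof (induction n)
    case 0
    then show ?case by (simp add: N_def emeasure_space_1)
  qed (use step order_trans in blast)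
  have hit: "prob {\<omega> \<in> space M. \<exists>k\<le>n. a \<le> (\<Prod>i=1..k. \<xi> i \<omega>)} \<le> 1 / a" for n
  proof -
    have le: "prob {\<omega> \<in> space M. \<exists>k\<le>n. a \<le> (\<Prod>i=1..k. \<xi> i \<omega>)} \<le> prob {\<omega> \<in> space M. a \<le> N n \<omega>}"
    proof (rule finite_measure_mono)
      show "{\<omega> \<in> space M. \<exists>k\<le>n. a \<le> (\<Prod>i=1..k. \<xi> i \<omega>)} \<subseteq> {\<omega> \<in> space M. a \<le> N n \<omega>}"
        unfolding N_def using frozen_product_ge[OF a1] by blast
    qed measurable
    have "ennreal (prob {\<omega> \<in> space M. a \<le> N n \<omega>}) = emeasure M {\<omega> \<in> space M. 1 \<le> ennreal (1 / a) * ennreal (N n \<omega>)}"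
    proof -
      have "1 \<le> ennreal (1 / a) * ennreal (N n \<omega>) \<longleftrightarrow> a \<le> N n \<omega>" for \<omega>
        using a N_nonneg[of n \<omega>]
        by (simp add: ennreal_mult[symmetric] ennreal_ge_1 field_simps)
      then show ?thesis by (simp add: emeasure_eq_measure)
    qed
    also have "\<dots> \<le> ennreal (1 / a) * (\<integral>\<^sup>+\<omega>. ennreal (N n \<omega>) * indicator (space M) \<omega> \<partial>M)"
      by (rule nn_integral_Markov_inequality) auto
    also have "\<dots> = ennreal (1 / a) * (\<integral>\<^sup>+\<omega>. ennreal (N n \<omega>) \<partial>M)"
      by (intro arg_cong2[where f="(*)"] nn_integral_cong) auto
    also have "\<dots> \<le> ennreal (1 / a) * 1"
      by (intro mult_left_mono N_le) auto
    finally have "prob {\<omega> \<in> space M. a \<le> N n \<omega>} \<le> 1 / a"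
      using a by simp
    with le show ?thesis by simp
  qed
  have "prob {\<omega> \<in> space M. \<exists>n. \<exists>k\<le>n. a \<le> (\<Prod>i=1..k. \<xi> i \<omega>)} \<le> 1 / a"
  proof (rule prob_countable_increasing_le)
    show "{\<omega> \<in> space M. \<exists>k\<le>n. a \<le> (\<Prod>i=1..k. \<xi> i \<omega>)} \<in> events" for n
      by measurable
  qed (use hit order_trans in blast)+
  also have "{\<omega> \<in> space M. \<exists>n. \<exists>k\<le>n. a \<le> (\<Prod>i=1..k. \<xi> i \<omega>)}
      = {\<omega> \<in> space M. \<exists>n. a \<le> (\<Prod>i=1..n. \<xi> i \<omega>)}"
    by blast
  finally show ?thesis .
qed

end

section \<open>The maximal ergodic inequality\<close>

text \<open>
  The maximum of \<open>0\<close> and the first \<open>n\<close> partial sums of \<open>x i - c\<close>. The recursion strips the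
  first term and shifts the sequence, which is the form in which the maximal ergodic inequality
  uses stationarity.
\<close>

primrec running_max :: "real \<Rightarrow> nat \<Rightarrow> (nat \<Rightarrow> real) \<Rightarrow> real" where
  "running_max c 0 x = 0"
| "running_max c (Suc n) x = max 0 (x 0 - c + running_max c n (\<lambda>i. x (Suc i)))"

lemma running_max_nonneg: "0 \<le> running_max c n x"
  by (cases n) auto

lemma running_max_mono: "running_max c n x \<le> running_max c (Suc n) x"
proof (induction n arbitrary: x)
  case (Suc n)
  from Suc[of "\<lambda>i. x (Suc i)"] show ?case by auto
qed simp

lemma running_max_ge:
  "k \<le> n \<Longrightarrow> (\<Sum>i<k. x i) - real k * c \<le> running_max c n x"
proof (induction n arbitrary: k x)
  case (Suc n)
  show ?case
  proof (cases k)
    case (Suc l)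
    have "(\<Sum>i<l. x (Suc i)) - real l * c \<le> running_max c n (\<lambda>i. x (Suc i))"
      using Suc.prems Suc by (intro Suc.IH) auto
    then show ?thesis
      by (simp add: Suc sum.lessThan_Suc_shift algebra_simps del: sum.lessThan_Suc)
  qed simp
qed simp

lemma running_max_measurable [measurable]:
  "running_max c n \<in> borel_measurable (PiM UNIV (\<lambda>_. borel))"
proof (induction n)
  case 0
  then show ?case by simp
next
  case (Suc n)
  note [measurable] = Suc
  have [measurable]: "(\<lambda>x i. x (Suc i)) \<in> measurable (PiM UNIV (\<lambda>_. borel)) (PiM UNIV (\<lambda>_. borel))"
    by (rule measurable_PiM_single') auto
  show ?case unfolding running_max.simps by measurable
qed

context prob_space
begin

lemma iid_distr_sequence:
  fixes Z :: "nat \<Rightarrow> 'a \<Rightarrow> real"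
  assumes "indep_vars (\<lambda>_. borel) Z {1..}"
    and "\<And>i. 1 \<le> i \<Longrightarrow> distr M borel (Z i) = D"
    and "inj r" and "\<And>i. 1 \<le> r i"
  shows "distr M (PiM UNIV (\<lambda>_. borel)) (\<lambda>\<omega> i. Z (r i) \<omega>) = PiM UNIV (\<lambda>_. D)"
proof -
  have "indep_vars (\<lambda>i. borel) (\<lambda>i. Z (r i)) UNIV"
  proof -
    have "indep_vars (\<lambda>j. PiM {r j} (\<lambda>_. borel)) (\<lambda>j \<omega>. \<lambda>i\<in>{r j}. Z i \<omega>) UNIV"
      using assms(3,4)
      by (intro indep_vars_restrict[OF assms(1)]) (auto simp: disjoint_family_on_def inj_def)
    from indep_vars_compose2[OF this, of "\<lambda>j x. x (r j)" "\<lambda>_. borel"] show ?thesis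
      by simp
  qed
  then have "distr M (PiM UNIV (\<lambda>_. borel)) (\<lambda>\<omega>. \<lambda>i\<in>UNIV. Z (r i) \<omega>)
      = PiM UNIV (\<lambda>i. distr M borel (Z (r i)))"
    using assms(1,4) by (subst (asm) indep_vars_iff_distr_eq_PiM) (auto simp: indep_vars_def)
  then show ?thesis
    using assms(2,4) by (simp add: restrict_UNIV)
qed

text \<open>
  Garsia's proof of the maximal ergodic inequality. Let \<open>G n\<close> be the running maximum of the walk with
  steps \<open>Z i - c\<close> and \<open>G' n\<close> that of the walk with its first step removed, so that
  \<open>G (n + 1) = max 0 (Z 1 - c + G' n)\<close>. Hence \<open>c + G (n + 1) = Z 1 + G' n\<close> on the event that
  the walk becomes nonnegative, and \<open>G (n + 1) \<le> Z 1 + G' n\<close> elsewhere. Taking expectations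
  gives the claim, since \<open>G' n\<close> has the law of \<open>G n\<close>, which is at most \<open>G (n + 1)\<close>.
\<close>

lemma iid_maximal_inequality:
  fixes Z :: "nat \<Rightarrow> 'a \<Rightarrow> real"
  assumes ind: "indep_vars (\<lambda>_. borel) Z {1..}"
    and law: "\<And>i. 1 \<le> i \<Longrightarrow> distr M borel (Z i) = distr M borel (Z 1)"
    and int: "integrable M (Z 1)"
    and nonneg: "\<And>i \<omega>. 0 \<le> Z i \<omega>"
    and c: "0 < c"
  shows "prob {\<omega> \<in> space M. \<exists>n\<ge>1. real n * c \<le> (\<Sum>i=1..n. Z i \<omega>)} \<le> expectation (Z 1) / c"
proof -
  have Z_meas [measurable]: "Z i \<in> borel_measurable M" if "1 \<le> i" for i
    using ind that by (auto simp: indep_vars_def)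
  define P where "P = PiM UNIV (\<lambda>_::nat. borel :: real measure)"
  define Y where "Y \<omega> = (\<lambda>i. Z (Suc i) \<omega>)" for \<omega>
  define Y' where "Y' \<omega> = (\<lambda>i. Z (Suc (Suc i)) \<omega>)" for \<omega>
  have [measurable]: "Y \<in> measurable M P" "Y' \<in> measurable M P"
    unfolding Y_def Y'_def P_def by (auto intro!: measurable_PiM_single')
  have same: "distr M P Y = distr M P Y'"
    using iid_distr_sequence[OF ind law, of Suc] iid_distr_sequence[OF ind law, of "\<lambda>i. Suc (Suc i)"]
    by (simp add: Y_def[abs_def] Y'_def[abs_def] P_def inj_def)
  have [measurable]: "running_max c n \<in> borel_measurable P" for n
    unfolding P_def by measurable
  define J where "J n = (\<integral>\<^sup>+\<omega>. ennreal (running_max c n (Y \<omega>)) \<partial>M)" for n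
  have J_shift: "(\<integral>\<^sup>+\<omega>. ennreal (running_max c n (Y' \<omega>)) \<partial>M) = J n" for n
  proof -
    have "J n = (\<integral>\<^sup>+x. ennreal (running_max c n x) \<partial>distr M P Y)"
      unfolding J_def by (rule nn_integral_distr[symmetric]) measurable
    also have "\<dots> = (\<integral>\<^sup>+\<omega>. ennreal (running_max c n (Y' \<omega>)) \<partial>M)"
      unfolding same by (rule nn_integral_distr) measurable
    finally show ?thesis by simp
  qed
  define A where "A n \<omega> \<longleftrightarrow> 0 \<le> Y \<omega> 0 - c + running_max c n (Y' \<omega>)" for n \<omega>
  have A_meas [measurable]: "Measurable.pred M (A n)" for n
    unfolding A_def Y_def by measurable
  have rec: "running_max c (Suc n) (Y \<omega>) = max 0 (Y \<omega> 0 - c + running_max c n (Y' \<omega>))" for n \<omega>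
    by (simp add: Y_def Y'_def)
  have EZ: "(\<integral>\<^sup>+\<omega>. ennreal (Y \<omega> 0) \<partial>M) = ennreal (expectation (Z 1))"
    unfolding Y_def using nn_integral_eq_integral[OF int] nonneg by simp
  have split: "ennreal c * emeasure M {\<omega> \<in> space M. A n \<omega>} + J (Suc n)
      \<le> ennreal (expectation (Z 1)) + J n" for n
  proof -
    have "ennreal c * emeasure M {\<omega> \<in> space M. A n \<omega>} + J (Suc n)
        = (\<integral>\<^sup>+\<omega>. ennreal c * indicator {\<omega> \<in> space M. A n \<omega>} \<omega>
            + ennreal (running_max c (Suc n) (Y \<omega>)) \<partial>M)"
      unfolding J_def by (subst nn_integral_add) (auto simp: nn_integral_cmult_indicator simp del: running_max.simps)
    also have "\<dots> \<le> (\<integral>\<^sup>+\<omega>. ennreal (Y \<omega> 0) + ennreal (running_max c n (Y' \<omega>)) \<partial>M)"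
    proof (rule nn_integral_mono)
      fix \<omega> assume "\<omega> \<in> space M"
      have "0 \<le> Y \<omega> 0" by (simp add: Y_def nonneg)
      with \<open>\<omega> \<in> space M\<close> show "ennreal c * indicator {\<omega> \<in> space M. A n \<omega>} \<omega>
          + ennreal (running_max c (Suc n) (Y \<omega>)) \<le> ennreal (Y \<omega> 0) + ennreal (running_max c n (Y' \<omega>))"
        unfolding rec using c running_max_nonneg[of c n "Y' \<omega>"]
        by (auto simp: A_def indicator_def ennreal_plus[symmetric] simp del: ennreal_plus intro!: ennreal_leI)
    qed
    also have "\<dots> = (\<integral>\<^sup>+\<omega>. ennreal (Y \<omega> 0) \<partial>M) + (\<integral>\<^sup>+\<omega>. ennreal (running_max c n (Y' \<omega>)) \<partial>M)"
      by (rule nn_integral_add) (auto simp: Y_def)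
    finally show ?thesis by (simp add: EZ J_shift)
  qed
  (* The expectations J n must be finite before they can be cancelled. *)
  have J_finite: "J n < \<infinity>" for n
  proof (induction n)
    case 0
    then show ?case by (simp add: J_def)
  next
    case (Suc n)
    have "J (Suc n) \<le> ennreal (expectation (Z 1)) + J n"
      using split[of n] by (rule order_trans[rotated]) simp
    also have "\<dots> < \<infinity>" using Suc by simp
    finally show ?case .
  qed
  have prob_A: "prob {\<omega> \<in> space M. A n \<omega>} \<le> expectation (Z 1) / c" for n
  proof -
    have "J n \<le> J (Suc n)"
      unfolding J_def by (intro nn_integral_mono ennreal_leI running_max_mono)
    then have "ennreal c * emeasure M {\<omega> \<in> space M. A n \<omega>} + J n \<le> ennreal (expectation (Z 1)) + J n"
      using split[of n] by (meson add_left_mono order_trans)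
    then have "ennreal c * emeasure M {\<omega> \<in> space M. A n \<omega>} \<le> ennreal (expectation (Z 1))"
      using J_finite[of n] by (auto simp: ennreal_add_left_cancel_le add.commute[of _ "J n"])
    then have "ennreal (c * prob {\<omega> \<in> space M. A n \<omega>}) \<le> ennreal (expectation (Z 1))"
      using c by (simp add: emeasure_eq_measure ennreal_mult)
    then have "c * prob {\<omega> \<in> space M. A n \<omega>} \<le> expectation (Z 1)"
      using nonneg by (subst (asm) ennreal_le_iff) (auto intro: integral_nonneg)
    then show ?thesis using c by (simp add: field_simps)
  qed
  have A_mono: "A m \<omega> \<Longrightarrow> A n \<omega>" if "m \<le> n" for m n \<omega>
    using that lift_Suc_mono_le[of "\<lambda>n. running_max c n (Y' \<omega>)" m n] running_max_mono
    unfolding A_def by fastforce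
  have hit: "\<exists>n. A n \<omega>" if "1 \<le> n" "real n * c \<le> (\<Sum>i=1..n. Z i \<omega>)" for n \<omega>
  proof -
    from that(1) obtain l where n: "n = Suc l" by (cases n) auto
    have "(\<Sum>i=1..n. Z i \<omega>) = (\<Sum>i<Suc l. Y \<omega> i)"
      unfolding n Y_def by (simp add: sum.atLeast1_atMost_eq)
    also have "\<dots> = Y \<omega> 0 + (\<Sum>i<l. Y' \<omega> i)"
      by (subst sum.lessThan_Suc_shift) (simp add: Y_def Y'_def)
    finally have "real n * c \<le> Y \<omega> 0 + (\<Sum>i<l. Y' \<omega> i)"
      using that(2) by simp
    with running_max_ge[of l l "Y' \<omega>" c] have "A l \<omega>"
      by (simp add: A_def n algebra_simps)
    then show ?thesis ..
  qed
  have "prob {\<omega> \<in> space M. \<exists>n\<ge>1. real n * c \<le> (\<Sum>i=1..n. Z i \<omega>)} \<le> prob {\<omega> \<in> space M. \<exists>n. A n \<omega>}"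
    using hit by (intro finite_measure_mono) auto
  also have "\<dots> \<le> expectation (Z 1) / c"
    using prob_A A_mono by (intro prob_countable_increasing_le) (auto simp: pred_def)
  finally show ?thesis .
qed

end

section \<open>A maximal law of large numbers with explicit constants\<close>

context prob_space
begin

text \<open>
  By Hoeffding's lemma \<open>exp (l * (\<Sum>i\<le>k. B i - b) - k * l\<^sup>2 * x\<^sup>2 / 2)\<close> is a product of
  independent factors of mean at most \<open>1\<close>; if the centred sum is at least \<open>k * d\<close>, then its exponent is at
  least \<open>k * (l * d - l\<^sup>2 * x\<^sup>2 / 2)\<close>, which the choice \<open>l = d / x\<^sup>2\<close> makes as large as possible. A single
  exponential thus controls all times \<open>k \<ge> m\<close> simultaneously.
\<close>

lemma bounded_line_crossing:
  fixes B :: "nat \<Rightarrow> 'a \<Rightarrow> real"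
  assumes ind: "indep_vars (\<lambda>_. borel) B {1..}"
    and bound: "\<And>i \<omega>. \<bar>B i \<omega>\<bar> \<le> x"
    and mean: "\<And>i. 1 \<le> i \<Longrightarrow> expectation (B i) = b"
    and "0 < x" "0 < d"
  shows "prob {\<omega> \<in> space M. \<exists>k\<ge>m. real k * d \<le> (\<Sum>i=1..k. B i \<omega> - b)}
    \<le> exp (- (real m * d\<^sup>2 / (2 * x\<^sup>2)))"
proof -
  define l where "l = d / x\<^sup>2"
  have "l > 0" using assms by (simp add: l_def)
  define \<xi> where "\<xi> i \<omega> = exp (l * (B i \<omega> - b) - l\<^sup>2 * x\<^sup>2 / 2)" for i \<omega>
  have B_meas [measurable]: "B i \<in> borel_measurable M" if "1 \<le> i" for i
    using ind that by (auto simp: indep_vars_def)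
  have ind\<xi>: "indep_vars (\<lambda>_. borel) \<xi> {1..}"
    unfolding \<xi>_def by (rule indep_vars_compose2[OF ind]) measurable
  have mean\<xi>: "(\<integral>\<^sup>+\<omega>. ennreal (\<xi> i \<omega>) \<partial>M) \<le> 1" if i: "1 \<le> i" for i
  proof -
    interpret B: interval_bounded_random_variable M "B i" "- x" x
      using bound[of i] i by unfold_locales (auto simp: abs_le_iff minus_le_iff)
    have "(\<integral>\<^sup>+\<omega>. ennreal (\<xi> i \<omega>) \<partial>M)
        = (\<integral>\<^sup>+\<omega>. ennreal (exp (- (l\<^sup>2 * x\<^sup>2 / 2))) * ennreal (exp (l * (B i \<omega> - b))) \<partial>M)"
      by (intro nn_integral_cong) (simp add: \<xi>_def ennreal_mult[symmetric] exp_add[symmetric])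
    also have "\<dots> = ennreal (exp (- (l\<^sup>2 * x\<^sup>2 / 2))) * (\<integral>\<^sup>+\<omega>. ennreal (exp (l * (B i \<omega> - b))) \<partial>M)"
      using i by (intro nn_integral_cmult) measurable
    also have "\<dots> \<le> ennreal (exp (- (l\<^sup>2 * x\<^sup>2 / 2))) * ennreal (exp (l\<^sup>2 * (x - - x)\<^sup>2 / 8))"
      using B.Hoeffdings_lemma_nn_integral[OF \<open>l > 0\<close>] mean[OF i] by (intro mult_left_mono) auto
    also have "\<dots> = 1"
      by (simp add: ennreal_mult[symmetric] exp_add[symmetric] power2_eq_square)
    finally show ?thesis .
  qed
  have "prob {\<omega> \<in> space M. \<exists>k\<ge>m. real k * d \<le> (\<Sum>i=1..k. B i \<omega> - b)}
      \<le> prob {\<omega> \<in> space M. \<exists>k. exp (real m * d\<^sup>2 / (2 * x\<^sup>2)) \<le> (\<Prod>i=1..k. \<xi> i \<omega>)}"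
  proof (rule finite_measure_mono)
    show "{\<omega> \<in> space M. \<exists>k\<ge>m. real k * d \<le> (\<Sum>i=1..k. B i \<omega> - b)}
      \<subseteq> {\<omega> \<in> space M. \<exists>k. exp (real m * d\<^sup>2 / (2 * x\<^sup>2)) \<le> (\<Prod>i=1..k. \<xi> i \<omega>)}"
    proof safe
      fix \<omega> k assume k: "m \<le> k" "real k * d \<le> (\<Sum>i=1..k. B i \<omega> - b)"
      have "real m * d\<^sup>2 / (2 * x\<^sup>2) \<le> real k * d\<^sup>2 / (2 * x\<^sup>2)"
        using k by (intro divide_right_mono mult_right_mono) auto
      also have "\<dots> = l * (real k * d) - real k * (l\<^sup>2 * x\<^sup>2 / 2)"
        using assms by (simp add: l_def field_simps power2_eq_square)
      also have "\<dots> \<le> l * (\<Sum>i=1..k. B i \<omega> - b) - real k * (l\<^sup>2 * x\<^sup>2 / 2)"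
        using k \<open>l > 0\<close> by (intro diff_right_mono mult_left_mono) auto
      also have "\<dots> = (\<Sum>i=1..k. l * (B i \<omega> - b) - l\<^sup>2 * x\<^sup>2 / 2)"
        by (simp add: sum_subtractf sum_distrib_left[symmetric])
      finally show "\<exists>k. exp (real m * d\<^sup>2 / (2 * x\<^sup>2)) \<le> (\<Prod>i=1..k. \<xi> i \<omega>)"
        unfolding \<xi>_def by (intro exI[of _ k]) (simp add: exp_sum[symmetric])
    qed
    have [measurable]: "\<xi> i \<in> borel_measurable M" if "1 \<le> i" for i
      using ind\<xi> that by (auto simp: indep_vars_def)
    show "{\<omega> \<in> space M. \<exists>k. exp (real m * d\<^sup>2 / (2 * x\<^sup>2)) \<le> (\<Prod>i=1..k. \<xi> i \<omega>)} \<in> events"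
      by measurable
  qed
  also have "\<dots> \<le> 1 / exp (real m * d\<^sup>2 / (2 * x\<^sup>2))"
    by (rule ville_indep_product[OF ind\<xi> _ mean\<xi>]) (auto simp: \<xi>_def)
  finally show ?thesis by (simp add: exp_minus field_simps)
qed

text \<open>
  Up to the mean \<open>b\<close> of the truncated variable, each \<open>Y i\<close> is at most the sum of a centred bounded
  variable and of \<open>\<bar>Y i\<bar>\<close> restricted to \<open>\<bar>Y i\<bar> \<ge> x\<close>. If the average exceeds \<open>d\<close>, one of the
  three contributes at least \<open>d / 3\<close>. Since \<open>Y 1\<close> has mean \<open>0\<close>, the truncation shifts
  the mean by at most \<open>U\<close>, so \<open>b \<ge> d / 3\<close> is possible only if \<open>3 * U / d \<ge> 1\<close>, when the
  claim is trivial.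
\<close>

lemma iid_average_upper_deviation:
  fixes Y :: "nat \<Rightarrow> 'a \<Rightarrow> real"
  assumes ind: "indep_vars (\<lambda>_. borel) Y {1..}"
    and law: "\<And>i. 1 \<le> i \<Longrightarrow> distr M borel (Y i) = distr M borel (Y 1)"
    and int: "integrable M (Y 1)" and mean: "expectation (Y 1) = 0"
    and m: "1 \<le> m" and x: "0 < x" and d: "0 < d"
  defines "U \<equiv> expectation (\<lambda>\<omega>. \<bar>Y 1 \<omega>\<bar> * of_bool (x \<le> \<bar>Y 1 \<omega>\<bar>))"
  shows "prob {\<omega> \<in> space M. \<exists>k\<ge>m. real k * d < (\<Sum>i=1..k. Y i \<omega>)}
    \<le> exp (- (real m * d\<^sup>2 / (18 * x\<^sup>2))) + 3 * U / d"
proof -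
  have Y_meas [measurable]: "Y i \<in> borel_measurable M" if "1 \<le> i" for i
    using ind that by (auto simp: indep_vars_def)
  define B where "B i \<omega> = Y i \<omega> * of_bool (\<bar>Y i \<omega>\<bar> < x)" for i \<omega>
  define Z where "Z i \<omega> = \<bar>Y i \<omega>\<bar> * of_bool (x \<le> \<bar>Y i \<omega>\<bar>)" for i \<omega>
  define b where "b = expectation (B 1)"
  have U: "U = expectation (Z 1)" by (simp add: U_def Z_def[abs_def])
  have "U \<ge> 0" unfolding U by (rule Bochner_Integration.integral_nonneg) (simp add: Z_def)
  have indB: "indep_vars (\<lambda>_. borel) B {1..}" and indZ: "indep_vars (\<lambda>_. borel) Z {1..}"
    unfolding B_def Z_def by (rule indep_vars_compose2[OF ind]; measurable)+
  have law_comp: "distr M borel (\<lambda>\<omega>. g (Y i \<omega>)) = distr M borel (\<lambda>\<omega>. g (Y 1 \<omega>))"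
    if i: "1 \<le> i" and [measurable]: "g \<in> borel_measurable borel" for i and g :: "real \<Rightarrow> real"
    using law[OF i] i distr_distr[of g borel borel "Y i" M] distr_distr[of g borel borel "Y 1" M]
    by (simp add: comp_def)
  have lawZ: "distr M borel (Z i) = distr M borel (Z 1)" if i: "1 \<le> i" for i
    unfolding Z_def by (rule law_comp[OF i]) measurable
  have lawB: "distr M borel (B i) = distr M borel (B 1)" if i: "1 \<le> i" for i
    unfolding B_def by (rule law_comp[OF i]) measurable
  have [measurable]: "B i \<in> borel_measurable M" "Z i \<in> borel_measurable M" if "1 \<le> i" for i
    using that unfolding B_def Z_def by measurable
  have meanB: "expectation (B i) = b" if i: "1 \<le> i" for i
  proof -
    have "expectation (B i) = (\<integral>y. y \<partial>distr M borel (B i))" if "1 \<le> i" for i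
      using that by (subst integral_distr) auto
    from this[OF i] this[of 1] lawB[OF i] show ?thesis
      by (simp only: b_def order_refl)
  qed
  have intZ: "integrable M (Z 1)"
    by (rule Bochner_Integration.integrable_bound[OF int]) (auto simp: Z_def)
  have "b \<le> U"
  proof -
    have "b \<le> expectation (\<lambda>\<omega>. Y 1 \<omega> + Z 1 \<omega>)"
      unfolding b_def
    proof (rule integral_mono)
      show "integrable M (B 1)"
        by (rule Bochner_Integration.integrable_bound[OF int]) (auto simp: B_def)
      show "integrable M (\<lambda>\<omega>. Y 1 \<omega> + Z 1 \<omega>)" using int intZ by simp
    qed (auto simp: B_def Z_def)
    also have "\<dots> = U" using int intZ mean by (simp add: U)
    finally show ?thesis .
  qed
  let ?E = "{\<omega> \<in> space M. \<exists>k\<ge>m. real k * d < (\<Sum>i=1..k. Y i \<omega>)}"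
  show ?thesis
  proof (cases "U < d / 3")
    case False
    then have "1 \<le> 3 * U / d" using d by (simp add: field_simps)
    then have "1 \<le> exp (- (real m * d\<^sup>2 / (18 * x\<^sup>2))) + 3 * U / d"
      by (intro add_increasing) auto
    then show ?thesis using prob_le_1 order_trans by blast
  next
    case True
    let ?F = "{\<omega> \<in> space M. \<exists>k\<ge>m. real k * (d / 3) \<le> (\<Sum>i=1..k. B i \<omega> - b)}"
    let ?G = "{\<omega> \<in> space M. \<exists>k\<ge>1. real k * (d / 3) \<le> (\<Sum>i=1..k. Z i \<omega>)}"
    have "prob ?E \<le> prob (?F \<union> ?G)"
    proof (rule finite_measure_mono)
      show "?E \<subseteq> ?F \<union> ?G"
      proof safe
        fix \<omega> k assume k: "m \<le> k" "real k * d < (\<Sum>i=1..k. Y i \<omega>)" "\<omega> \<in> space M"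
          and no: "\<not> (\<exists>k\<ge>1. real k * (d / 3) \<le> (\<Sum>i=1..k. Z i \<omega>))"
        have "real k * d < (\<Sum>i=1..k. Y i \<omega>)" by fact
        also have "\<dots> \<le> (\<Sum>i=1..k. (B i \<omega> - b) + Z i \<omega> + b)"
          by (rule sum_mono) (auto simp: B_def Z_def)
        also have "\<dots> = (\<Sum>i=1..k. B i \<omega> - b) + (\<Sum>i=1..k. Z i \<omega>) + real k * b"
          by (simp add: sum.distrib sum_subtractf)
        finally have "real k * d < (\<Sum>i=1..k. B i \<omega> - b) + (\<Sum>i=1..k. Z i \<omega>) + real k * b" .
        moreover have "real k * b \<le> real k * (d / 3)"
          using \<open>b \<le> U\<close> True by (intro mult_left_mono) auto
        moreover have "(\<Sum>i=1..k. Z i \<omega>) < real k * (d / 3)"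
          using no k m by (meson not_le order_trans)
        ultimately have "real k * (d / 3) \<le> (\<Sum>i=1..k. B i \<omega> - b)"
          by (simp add: field_simps)
        then show "\<exists>k\<ge>m. real k * (d / 3) \<le> (\<Sum>i=1..k. B i \<omega> - b)"
          using k by blast
      qed
      show "?F \<union> ?G \<in> events" by measurable
    qed
    also have "\<dots> \<le> prob ?F + prob ?G"
      by (rule measure_Un_le) measurable
    also have "\<dots> \<le> exp (- (real m * (d / 3)\<^sup>2 / (2 * x\<^sup>2))) + expectation (Z 1) / (d / 3)"
    proof (rule add_mono)
      show "prob ?F \<le> exp (- (real m * (d / 3)\<^sup>2 / (2 * x\<^sup>2)))"
        using x d meanB by (intro bounded_line_crossing[OF indB]) (auto simp: B_def)
      show "prob ?G \<le> expectation (Z 1) / (d / 3)"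
        using d by (intro iid_maximal_inequality[OF indZ lawZ intZ]) (auto simp: Z_def)
    qed
    finally show ?thesis by (simp add: U power_divide mult.commute)
  qed
qed

end

section \<open>Stitched self-normalised boundaries\<close>

lemma zeta_series_summable:
  "1 < z \<Longrightarrow> summable (\<lambda>i. real (Suc i) powr (- z))"
  using summable_real_powr_iff[of "- z"] by (subst summable_Suc_iff) simp

lemma zeta_series_ge_1:
  assumes "1 < z"
  shows "1 \<le> zeta_series z"
  using sum_le_suminf[OF zeta_series_summable[OF assms], of "{0}"]
  by (simp add: zeta_series_def)

text \<open>
  By the mean value theorem each term is at most the corresponding difference of
  \<open>n powr (- \<epsilon>) / \<epsilon>\<close>, and these differences telescope.
\<close>

lemma powr_tail_sum_le:
  fixes \<epsilon> :: real
  assumes e: "0 < \<epsilon>" and i0: "1 \<le> i0"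
  shows "summable (\<lambda>n. real (Suc (i0 + n)) powr (- (1 + \<epsilon>)))"
    and "(\<Sum>n. real (Suc (i0 + n)) powr (- (1 + \<epsilon>))) \<le> real i0 powr (- \<epsilon>) / \<epsilon>"
proof -
  define f where "f n = real (i0 + n) powr (- \<epsilon>) / \<epsilon>" for n
  have "filterlim (\<lambda>n. real (i0 + n)) at_top sequentially"
    by real_asymp
  then have "((\<lambda>n. real (i0 + n) powr (- \<epsilon>)) \<longlongrightarrow> 0) sequentially"
    using e by (intro tendsto_neg_powr) auto
  then have "f \<longlonglongrightarrow> 0"
    unfolding f_def using tendsto_divide_zero by blast
  then have sums: "(\<lambda>n. f n - f (Suc n)) sums (f 0 - 0)"
    by (rule telescope_sums')
  show s: "summable (\<lambda>n. real (Suc (i0 + n)) powr (- (1 + \<epsilon>)))"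
    using summable_ignore_initial_segment[OF zeta_series_summable[of "1 + \<epsilon>"], of i0] e
    by (simp add: add.commute)
  have step: "real (Suc (i0 + n)) powr (- (1 + \<epsilon>)) \<le> f n - f (Suc n)" for n
  proof -
    let ?a = "real (i0 + n)"
    have "\<exists>z>?a. z < ?a + 1 \<and> (?a + 1) powr (- \<epsilon>) / \<epsilon> - ?a powr (- \<epsilon>) / \<epsilon>
        = (?a + 1 - ?a) * (- (z powr (- (1 + \<epsilon>))))"
    proof (rule MVT2)
      fix x assume "?a \<le> x" "x \<le> ?a + 1"
      then have "0 < x" using i0 by simp
      then show "((\<lambda>x. x powr (- \<epsilon>) / \<epsilon>) has_real_derivative - (x powr (- (1 + \<epsilon>)))) (at x)"
        using e by (auto intro!: derivative_eq_intros simp: powr_diff powr_minus powr_add field_simps)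
    qed simp
    then obtain z where z: "?a < z" "z < ?a + 1" "f n - f (Suc n) = z powr (- (1 + \<epsilon>))"
      by (auto simp: f_def add.commute)
    have "(?a + 1) powr (- (1 + \<epsilon>)) \<le> z powr (- (1 + \<epsilon>))"
      using z i0 e by (intro powr_mono2') auto
    then show ?thesis using z(3) by (simp add: add.commute)
  qed
  have "(\<Sum>n. real (Suc (i0 + n)) powr (- (1 + \<epsilon>))) \<le> (\<Sum>n. f n - f (Suc n))"
    using sums by (intro suminf_le step s) (auto simp: sums_iff)
  also have "\<dots> = f 0" using sums by (simp add: sums_iff)
  finally show "(\<Sum>n. real (Suc (i0 + n)) powr (- (1 + \<epsilon>))) \<le> real i0 powr (- \<epsilon>) / \<epsilon>"
    by (simp add: f_def)
qed

text \<open>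
  The level that the exponent must reach in epoch \<open>i\<close>, chosen so that the resulting bounds
  \<open>exp (- epoch_level \<eta> i)\<close>, doubled for the two signs and summed over all \<open>i\<close>, add up to \<open>1\<close>.
\<close>

definition epoch_level :: "real \<Rightarrow> nat \<Rightarrow> real" where
  "epoch_level \<eta> i = ln (2 * zeta_series \<eta> * real (Suc i) powr \<eta>)"

text \<open>
  For a clock value \<open>v\<close> the least \<open>s\<close> with \<open>a \<le> l * s - l\<^sup>2 / 2 * v\<close>, where \<open>a\<close> is the
  level, is smallest for \<open>l = sqrt (2 * a / v)\<close>; the slope is this optimum at the geometric centre
  \<open>v = \<eta> powr (i + 1 / 2)\<close> of the epoch.
\<close>

definition epoch_slope :: "real \<Rightarrow> nat \<Rightarrow> real" where
  "epoch_slope \<eta> i = sqrt (2 * epoch_level \<eta> i / \<eta> powr (real i + 1 / 2))"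

text \<open>
  In the notation of the proof, \<open>t = sqrt (v / q)\<close> measures the position of the clock within the
  epoch, relative to the geometric centre \<open>q\<close>, and ranges over \<open>{1 / p..p}\<close>. The line at \<open>v\<close> has
  height \<open>(t + 1 / t) / sqrt 2 * sqrt (v * a)\<close>, which is largest at the two ends; so it suffices that the
  boundary is at least \<open>(p + 1 / p) / sqrt 2 * sqrt (v * a)\<close>. The powers in
  \<open>c_const \<epsilon>\<close> are \<open>\<eta>\<close> times this factor: one \<open>sqrt \<eta>\<close> compensates for \<open>v \<le> \<eta> * k\<close>,
  and the other for the exponent \<open>\<eta>\<close> of \<open>Suc i\<close> in the level.
\<close>

lemma boundary_above_epoch_line:
  fixes \<epsilon> v s :: real and k i :: nat
  defines "\<eta> \<equiv> 1 + \<epsilon>"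
  assumes e: "0 < \<epsilon>" and v: "\<eta> powr real i \<le> v" "v \<le> \<eta> powr (real i + 1)" "v \<le> \<eta> * real k"
    and s: "c_const \<epsilon> * sqrt (real k * (ln (ln (\<eta>\<^sup>2 * real k)) + l_const \<epsilon>)) \<le> s"
  shows "epoch_level \<eta> i \<le> epoch_slope \<eta> i * s - (epoch_slope \<eta> i)\<^sup>2 / 2 * v"
proof -
  define z where "z = zeta_series \<eta>"
  define a where "a = epoch_level \<eta> i"
  define q where "q = \<eta> powr (real i + 1 / 2)"
  define p where "p = \<eta> powr (1 / 4)"
  define t where "t = sqrt (v / q)"
  define h where "h = ln (ln (\<eta>\<^sup>2 * real k)) + l_const \<epsilon>"
  have eta: "1 < \<eta>" and ln_eta: "0 < ln \<eta>" using e by (auto simp: \<eta>_def)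
  have z: "1 \<le> z" unfolding z_def using eta by (rule zeta_series_ge_1)
  have pos: "0 < q" "0 < p" using eta by (auto simp: q_def p_def)
  have "0 < \<eta> powr real i" using eta by simp
  then have v0: "0 < v" using v(1) by (rule less_le_trans)
  have a_eq: "a = ln (2 * z) + \<eta> * ln (real (Suc i))"
    unfolding a_def epoch_level_def z_def[symmetric] using z by (simp add: ln_mult ln_powr)
  have ln2z: "0 < ln (2 * z)" using z by simp
  have a0: "0 < a" unfolding a_eq using ln2z eta by (intro add_pos_nonneg) auto
  have "0 < \<eta> * real k" using v0 v(3) by (rule less_le_trans)
  then have k0: "0 < real k" using eta by (simp add: zero_less_mult_iff)
  have "(real i + 1) * ln \<eta> = ln (\<eta> * \<eta> powr real i)"
    using eta by (simp add: ln_mult ln_powr algebra_simps)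
  also have "\<dots> \<le> ln (\<eta>\<^sup>2 * real k)"
  proof (subst ln_le_cancel_iff)
    have "\<eta> * \<eta> powr real i \<le> \<eta> * (\<eta> * real k)"
      using v eta by (intro mult_left_mono) auto
    then show "\<eta> * \<eta> powr real i \<le> \<eta>\<^sup>2 * real k"
      by (simp add: power2_eq_square mult.assoc)
  qed (use eta k0 in auto)
  finally have lnk: "(real i + 1) * ln \<eta> \<le> ln (\<eta>\<^sup>2 * real k)" .
  have "ln ((real i + 1) * ln \<eta>) \<le> ln (ln (\<eta>\<^sup>2 * real k))"
    using lnk ln_eta by (subst ln_le_cancel_iff) (auto intro: less_le_trans[OF _ lnk])
  moreover have "l_const \<epsilon> = ln (2 * z) - ln (ln \<eta>)"
    using z ln_eta by (simp add: l_const_def z_def \<eta>_def ln_div)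
  moreover have "ln ((real i + 1) * ln \<eta>) = ln (real (Suc i)) + ln (ln \<eta>)"
    using ln_eta by (subst ln_mult) (auto simp: add.commute)
  ultimately have h: "ln (2 * z) + ln (real (Suc i)) \<le> h"
    by (simp add: h_def)
  have "a \<le> \<eta> * (ln (2 * z) + ln (real (Suc i)))"
    unfolding a_eq using ln2z eta by (simp add: algebra_simps)
  also have "\<dots> \<le> \<eta> * h" using h eta by (intro mult_left_mono) auto
  finally have ah: "a \<le> \<eta> * h" .
  have "v * a \<le> (\<eta> * real k) * (\<eta> * h)"
    using v(3) ah a0 v0 eta by (intro mult_mono) auto
  also have "\<dots> = \<eta>\<^sup>2 * (real k * h)" by (simp add: power2_eq_square)
  finally have "sqrt (v * a) \<le> sqrt (\<eta>\<^sup>2 * (real k * h))" by simp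
  also have "\<dots> = \<eta> * sqrt (real k * h)" using eta by (simp add: real_sqrt_mult)
  finally have kh: "sqrt (v * a) \<le> \<eta> * sqrt (real k * h)" .
  have "\<eta> powr (5/4) = \<eta> * p" "\<eta> powr (3/4) = \<eta> / p"
    using eta powr_add[of \<eta> 1 "1/4"] powr_diff[of \<eta> 1 "1/4"] by (simp_all add: p_def)
  then have c: "c_const \<epsilon> = \<eta> * ((p + 1 / p) / sqrt 2)"
    by (simp add: c_const_def \<eta>_def[symmetric] field_simps)
  have "(p + 1 / p) / sqrt 2 * sqrt (v * a) \<le> (p + 1 / p) / sqrt 2 * (\<eta> * sqrt (real k * h))"
    using kh pos by (intro mult_left_mono) auto
  also have "\<dots> \<le> s" using s unfolding c h_def by (simp add: mult_ac)
  finally have s_ge: "(p + 1 / p) / sqrt 2 * sqrt (v * a) \<le> s" .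
  have slope: "epoch_slope \<eta> i = sqrt (2 * a / q)"
    by (simp add: epoch_slope_def a_def q_def)
  have t: "1 / p \<le> t" "t \<le> p"
  proof -
    have "sqrt (\<eta> powr r) = \<eta> powr (r / 2)" for r
      using powr_half_sqrt[of "\<eta> powr r"] by (simp add: powr_powr)
    then have "1 / p = sqrt (\<eta> powr (- 1/2))" "p = sqrt (\<eta> powr (1 / 2))"
      using powr_minus_divide[of \<eta> "1 / 4"] by (simp_all add: p_def)
    moreover have "\<eta> powr (- 1/2) \<le> v / q" "v / q \<le> \<eta> powr (1 / 2)"
    proof -
      have "\<eta> powr (- 1/2) * q = \<eta> powr real i" "\<eta> powr (1/2) * q = \<eta> powr (real i + 1)"
        by (simp_all add: q_def powr_add[symmetric] add.commute)
      then show "\<eta> powr (- 1/2) \<le> v / q" "v / q \<le> \<eta> powr (1 / 2)"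
        using v pos by (simp_all add: pos_le_divide_eq pos_divide_le_eq)
    qed
    ultimately show "1 / p \<le> t" "t \<le> p" unfolding t_def by (metis real_sqrt_le_iff)+
  qed
  (* This product expresses that t + 1 / t is at most p + 1 / p. *)
  have "0 \<le> (p - t) * (t - 1 / p)"
    using t by (intro mult_nonneg_nonneg) auto
  also have "\<dots> = (p + 1 / p) * t - t\<^sup>2 - 1"
    using pos by (simp add: field_simps power2_eq_square)
  finally have "a * 1 \<le> a * ((p + 1 / p) * t - t\<^sup>2)"
    using a0 by (intro mult_left_mono) auto
  also have "\<dots> = sqrt (2 * a / q) * ((p + 1 / p) / sqrt 2 * sqrt (v * a)) - (sqrt (2 * a / q))\<^sup>2 / 2 * v"
  proof -
    have "sqrt (2 * a / q) * ((p + 1 / p) / sqrt 2 * sqrt (v * a)) = (p + 1 / p) * (sqrt a * sqrt a) * t"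
      by (simp add: t_def real_sqrt_mult real_sqrt_divide)
    also have "\<dots> = a * ((p + 1 / p) * t)" using a0 by simp
    moreover have "t\<^sup>2 = v / q" using v0 pos by (simp add: t_def)
    moreover have "(sqrt (2 * a / q))\<^sup>2 = 2 * a / q" using a0 pos by simp
    ultimately show ?thesis by (simp add: algebra_simps)
  qed
  also have "\<dots> \<le> epoch_slope \<eta> i * s - (epoch_slope \<eta> i)\<^sup>2 / 2 * v"
    unfolding slope using s_ge a0 pos by (intro diff_right_mono mult_left_mono) auto
  finally show ?thesis by (simp add: a_def)
qed

lemma exp_neg_epoch_level:
  assumes "1 < \<eta>"
  shows "2 * exp (- epoch_level \<eta> i) = real (Suc i) powr (- \<eta>) / zeta_series \<eta>"
  using zeta_series_ge_1[OF assms]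
  by (simp add: epoch_level_def exp_minus powr_minus field_simps)

context prob_space
begin

text \<open>
  By \<open>exp_sub_square_le\<close> the \<open>i\<close>-th factor of the exponential is at most
  \<open>exp (- l\<^sup>2 / 3) * (1 + l * R i + l\<^sup>2 / 3 * (R i)\<^sup>2)\<close>, whose mean is
  \<open>exp (- l\<^sup>2 / 3) * (1 + l\<^sup>2 / 3) \<le> 1\<close>. Mixing the observed squares with the variance in the
  clock is what permits this with only two moments.
\<close>

lemma self_normalized_line_crossing:
  fixes R :: "nat \<Rightarrow> 'a \<Rightarrow> real" and l a :: real
  assumes ind: "indep_vars (\<lambda>_. borel) R {1..}"
    and int: "\<And>i. 1 \<le> i \<Longrightarrow> integrable M (R i)" "\<And>i. 1 \<le> i \<Longrightarrow> integrable M (\<lambda>\<omega>. (R i \<omega>)\<^sup>2)"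
    and mean: "\<And>i. 1 \<le> i \<Longrightarrow> expectation (R i) = 0"
    and var: "\<And>i. 1 \<le> i \<Longrightarrow> expectation (\<lambda>\<omega>. (R i \<omega>)\<^sup>2) = 1"
  shows "prob {\<omega> \<in> space M. \<exists>k. a \<le> l * (\<Sum>i=1..k. R i \<omega>)
      - l\<^sup>2 / 2 * (\<Sum>i=1..k. ((R i \<omega>)\<^sup>2 + 2) / 3)} \<le> exp (- a)"
proof -
  define \<xi> where "\<xi> i \<omega> = exp (l * R i \<omega> - l\<^sup>2 / 2 * (((R i \<omega>)\<^sup>2 + 2) / 3))" for i \<omega>
  have ind\<xi>: "indep_vars (\<lambda>_. borel) \<xi> {1..}"
    unfolding \<xi>_def by (rule indep_vars_compose2[OF ind]) measurable
  have mean\<xi>: "(\<integral>\<^sup>+\<omega>. ennreal (\<xi> i \<omega>) \<partial>M) \<le> 1" if i: "1 \<le> i" for i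
  proof -
    let ?q = "\<lambda>\<omega>. exp (- (l\<^sup>2 / 3)) * (1 + l * R i \<omega> + l\<^sup>2 / 3 * (R i \<omega>)\<^sup>2)"
    have le: "\<xi> i \<omega> \<le> ?q \<omega>" for \<omega>
    proof -
      have "\<xi> i \<omega> = exp (- (l\<^sup>2 / 3)) * exp (l * R i \<omega> - (l * R i \<omega>)\<^sup>2 / 6)"
        by (simp add: \<xi>_def exp_add[symmetric] field_simps)
      also have "\<dots> \<le> exp (- (l\<^sup>2 / 3)) * (1 + l * R i \<omega> + (l * R i \<omega>)\<^sup>2 / 3)"
        by (intro mult_left_mono exp_sub_square_le) auto
      finally show ?thesis by (simp add: power_mult_distrib)
    qed
    have q_nonneg: "0 \<le> ?q \<omega>" for \<omega>
      using le[of \<omega>] by (rule order_trans[rotated]) (simp add: \<xi>_def)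
    have "(\<integral>\<^sup>+\<omega>. ennreal (\<xi> i \<omega>) \<partial>M) \<le> (\<integral>\<^sup>+\<omega>. ennreal (?q \<omega>) \<partial>M)"
      by (intro nn_integral_mono ennreal_leI le)
    also have "\<dots> = ennreal (expectation ?q)"
      using int[OF i] q_nonneg by (intro nn_integral_eq_integral) auto
    finally have le_q: "(\<integral>\<^sup>+\<omega>. ennreal (\<xi> i \<omega>) \<partial>M) \<le> ennreal (expectation ?q)" .
    have "expectation ?q = exp (- (l\<^sup>2 / 3)) * (1 + l\<^sup>2 / 3)"
      using int[OF i] mean[OF i] var[OF i] by (simp add: prob_space)
    also have "\<dots> \<le> exp (- (l\<^sup>2 / 3)) * exp (l\<^sup>2 / 3)"
      by (intro mult_left_mono exp_ge_add_one_self) auto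
    also have "\<dots> = 1" by (simp add: exp_minus)
    finally show ?thesis using le_q by (simp add: ennreal_le_1 order_trans)
  qed
  have "prob {\<omega> \<in> space M. \<exists>k. a \<le> l * (\<Sum>i=1..k. R i \<omega>)
      - l\<^sup>2 / 2 * (\<Sum>i=1..k. ((R i \<omega>)\<^sup>2 + 2) / 3)}
      = prob {\<omega> \<in> space M. \<exists>k. exp a \<le> (\<Prod>i=1..k. \<xi> i \<omega>)}"
  proof -
    have "(\<Prod>i=1..k. \<xi> i \<omega>) = exp (l * (\<Sum>i=1..k. R i \<omega>)
        - l\<^sup>2 / 2 * (\<Sum>i=1..k. ((R i \<omega>)\<^sup>2 + 2) / 3))" for k \<omega>
      unfolding \<xi>_def by (simp add: exp_sum[symmetric] sum_subtractf sum_distrib_left)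
    then show ?thesis by simp
  qed
  also have "\<dots> \<le> 1 / exp a"
    by (rule ville_indep_product[OF ind\<xi> _ mean\<xi>]) (auto simp: \<xi>_def)
  finally show ?thesis by (simp add: exp_minus field_simps)
qed

text \<open>
  The union bound over the epochs from \<open>i0\<close> on, with slopes of both signs for the absolute value.
\<close>

lemma stitched_boundary_crossing:
  fixes R :: "nat \<Rightarrow> 'a \<Rightarrow> real" and \<epsilon> :: real
  assumes ind: "indep_vars (\<lambda>_. borel) R {1..}"
    and int: "\<And>i. 1 \<le> i \<Longrightarrow> integrable M (R i)" "\<And>i. 1 \<le> i \<Longrightarrow> integrable M (\<lambda>\<omega>. (R i \<omega>)\<^sup>2)"
    and mean: "\<And>i. 1 \<le> i \<Longrightarrow> expectation (R i) = 0"
    and var: "\<And>i. 1 \<le> i \<Longrightarrow> expectation (\<lambda>\<omega>. (R i \<omega>)\<^sup>2) = 1"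
    and e: "0 < \<epsilon>" and i0: "1 \<le> i0"
  defines "W \<equiv> \<lambda>k \<omega>. \<Sum>i=1..k. ((R i \<omega>)\<^sup>2 + 2) / 3"
  shows "prob {\<omega> \<in> space M. \<exists>k. (1 + \<epsilon>) powr real i0 \<le> W k \<omega> \<and> W k \<omega> \<le> (1 + \<epsilon>) * real k \<and>
      c_const \<epsilon> * sqrt (real k * (ln (ln ((1 + \<epsilon>)\<^sup>2 * real k)) + l_const \<epsilon>)) \<le> \<bar>\<Sum>i=1..k. R i \<omega>\<bar>}
    \<le> real i0 powr (- \<epsilon>) / (\<epsilon> * zeta_series (1 + \<epsilon>))"
    (is "prob ?E \<le> _")
proof -
  define \<eta> where "\<eta> = 1 + \<epsilon>"
  have eta: "1 < \<eta>" using e by (simp add: \<eta>_def)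
  have [measurable]: "R i \<in> borel_measurable M" if "1 \<le> i" for i
    using ind that by (auto simp: indep_vars_def)
  define L where "L l i = {\<omega> \<in> space M. \<exists>k. epoch_level \<eta> i \<le> l * (\<Sum>i=1..k. R i \<omega>) - l\<^sup>2 / 2 * W k \<omega>}"
    for l i
  have L_meas [measurable]: "L l i \<in> events" for l i
    unfolding L_def W_def by measurable
  have L_prob: "prob (L l i) \<le> exp (- epoch_level \<eta> i)" for l i
    unfolding L_def W_def by (rule self_normalized_line_crossing) fact+
  define A where "A i = L (epoch_slope \<eta> i) i \<union> L (- epoch_slope \<eta> i) i" for i
  have A_prob: "prob (A i) \<le> real (Suc i) powr (- \<eta>) / zeta_series \<eta>" for i
  proof -
    have "prob (A i) \<le> prob (L (epoch_slope \<eta> i) i) + prob (L (- epoch_slope \<eta> i) i)"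
      unfolding A_def by (rule measure_Un_le) auto
    also have "\<dots> \<le> 2 * exp (- epoch_level \<eta> i)"
      using L_prob[of "epoch_slope \<eta> i" i] L_prob[of "- epoch_slope \<eta> i" i] by simp
    finally show ?thesis by (simp add: exp_neg_epoch_level[OF eta])
  qed
  have sub: "?E \<subseteq> (\<Union>n. A (i0 + n))"
  proof safe
    fix \<omega> k
    assume \<omega>: "\<omega> \<in> space M" and W: "(1 + \<epsilon>) powr real i0 \<le> W k \<omega>" "W k \<omega> \<le> (1 + \<epsilon>) * real k"
      and cross: "c_const \<epsilon> * sqrt (real k * (ln (ln ((1 + \<epsilon>)\<^sup>2 * real k)) + l_const \<epsilon>))
        \<le> \<bar>\<Sum>i=1..k. R i \<omega>\<bar>"
    define i where "i = nat \<lfloor>log \<eta> (W k \<omega>)\<rfloor>"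
    have W0: "0 < W k \<omega>"
      using W(1) e by (intro less_le_trans[OF _ W(1)]) auto
    have "real i0 \<le> log \<eta> (W k \<omega>)"
      using W(1) W0 eta by (simp add: le_log_iff \<eta>_def)
    then have i: "i0 \<le> i" "real i \<le> log \<eta> (W k \<omega>)" "log \<eta> (W k \<omega>) \<le> real i + 1"
      unfolding i_def by (auto simp: le_nat_iff le_floor_iff)
    then have "\<eta> powr real i \<le> W k \<omega>" "W k \<omega> \<le> \<eta> powr (real i + 1)"
      using W0 eta by (simp_all add: le_log_iff log_le_iff)
    then have "epoch_level \<eta> i \<le> epoch_slope \<eta> i * \<bar>\<Sum>i=1..k. R i \<omega>\<bar> - (epoch_slope \<eta> i)\<^sup>2 / 2 * W k \<omega>"
      unfolding \<eta>_def using e W(2) cross by (intro boundary_above_epoch_line)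
    then have "\<omega> \<in> A i"
      using \<omega> unfolding A_def L_def by (cases "0 \<le> (\<Sum>i=1..k. R i \<omega>)") auto
    with i(1) show "\<omega> \<in> (\<Union>n. A (i0 + n))"
      by (intro UN_I[of "i - i0"]) auto
  qed
  note tail = powr_tail_sum_le[OF e i0, folded \<eta>_def]
  have bound_summable: "summable (\<lambda>n. real (Suc (i0 + n)) powr (- \<eta>) / zeta_series \<eta>)"
    using tail(1) by (rule summable_divide)
  have A_summable: "summable (\<lambda>n. prob (A (i0 + n)))"
    by (rule summable_comparison_test'[OF bound_summable, of 0]) (simp only: real_norm_def abs_of_nonneg measure_nonneg A_prob)
  have A_meas: "A i \<in> events" for i by (auto simp: A_def)
  have "prob ?E \<le> prob (\<Union>n. A (i0 + n))"
    using sub A_meas by (intro finite_measure_mono) auto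
  also have "\<dots> \<le> (\<Sum>n. prob (A (i0 + n)))"
    using A_meas A_summable by (intro finite_measure_subadditive_countably) auto
  also have "\<dots> \<le> (\<Sum>n. real (Suc (i0 + n)) powr (- \<eta>) / zeta_series \<eta>)"
    by (intro suminf_le A_prob A_summable bound_summable)
  also have "\<dots> = (\<Sum>n. real (Suc (i0 + n)) powr (- \<eta>)) / zeta_series \<eta>"
    by (rule suminf_divide[OF tail(1)])
  also have "\<dots> \<le> (real i0 powr (- \<epsilon>) / \<epsilon>) / zeta_series \<eta>"
    using tail(2) zeta_series_ge_1[OF eta] by (intro divide_right_mono) auto
  finally show ?thesis by (simp add: \<eta>_def)
qed

end

section \<open>Asymptotics of the boundary\<close>

lemma c_const_tendsto: "(\<lambda>j. c_const (1 / real j)) \<longlonglongrightarrow> sqrt 2"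
proof -
  have "(\<lambda>j::nat. (1 + 1 / real j) powr (5 / 4)) \<longlonglongrightarrow> 1" "(\<lambda>j::nat. (1 + 1 / real j) powr (3 / 4)) \<longlonglongrightarrow> 1"
    by real_asymp+
  then have "(\<lambda>j. c_const (1 / real j)) \<longlonglongrightarrow> (1 + 1) / sqrt 2"
    unfolding c_const_def by (intro tendsto_intros) simp_all
  then show ?thesis by (simp add: real_div_sqrt)
qed

text \<open>
  The constants \<open>b\<close> and \<open>l\<close> disappear in the limit: \<open>ln (ln (b * k)) + l\<close> is asymptotic to
  \<open>ln (ln k)\<close>.
\<close>

lemma boundary_eventually_less:
  fixes b l c q :: real
  assumes b: "1 \<le> b" and c: "0 < c" "c < q * sqrt 2"
  shows "\<forall>\<^sub>F k in sequentially. 0 < ln (ln (real k)) \<and> 0 < c * sqrt (real k * (ln (ln (b * real k)) + l))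
    \<and> c * sqrt (real k * (ln (ln (b * real k)) + l)) \<le> q * sqrt (2 * real k * ln (ln (real k)))"
proof -
  have "0 < b" using b by simp
  then have 1: "(\<lambda>k. (ln (ln (b * real k)) + l) / ln (ln (real k))) \<longlonglongrightarrow> 1" by real_asymp
  have q: "0 < q" using c by (metis less_trans mult_less_0_iff not_less_iff_gr_or_eq real_sqrt_gt_0_iff zero_less_mult_iff zero_less_numeral)
  have "1 < (q * sqrt 2 / c)\<^sup>2"
    using c by (intro one_less_power) (auto simp: field_simps)
  from order_tendstoD(2)[OF 1 this] order_tendstoD(1)[OF 1 zero_less_one]
  have "\<forall>\<^sub>F k in sequentially. (ln (ln (b * real k)) + l) / ln (ln (real k)) < (q * sqrt 2 / c)\<^sup>2"
    "\<forall>\<^sub>F k in sequentially. 0 < (ln (ln (b * real k)) + l) / ln (ln (real k))" .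
  moreover have "\<forall>\<^sub>F k in sequentially. 0 < ln (ln (real k))" by real_asymp
  ultimately show ?thesis
    using eventually_gt_at_top[of "0::nat"]
  proof eventually_elim
    case (elim k)
    define h where "h = ln (ln (b * real k)) + l"
    have h: "0 < h" using elim by (simp add: h_def zero_less_divide_iff)
    have "h \<le> (q * sqrt 2 / c)\<^sup>2 * ln (ln (real k))"
      using elim by (simp add: h_def pos_divide_less_eq)
    then have "real k * h \<le> real k * ((q * sqrt 2 / c)\<^sup>2 * ln (ln (real k)))"
      by (rule mult_left_mono) simp
    then have "sqrt (real k * h) \<le> sqrt ((q / c)\<^sup>2 * (2 * real k * ln (ln (real k))))"
      by (simp add: power_divide power_mult_distrib mult_ac)
    also have "\<dots> = q / c * sqrt (2 * real k * ln (ln (real k)))"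
      using q c by (simp add: real_sqrt_mult)
    finally have "c * sqrt (real k * h) \<le> c * (q / c * sqrt (2 * real k * ln (ln (real k))))"
      using c by (intro mult_left_mono) auto
    then have "c * sqrt (real k * h) \<le> q * sqrt (2 * real k * ln (ln (real k)))"
      using c by simp
    moreover have "0 < c * sqrt (real k * h)" using elim h c by simp
    ultimately show ?case unfolding h_def using elim by blast
  qed
qed

section \<open>The crossing probability of a single boundary\<close>

text \<open>
  The left-hand side of the inequality by which \<^const>\<open>m_index\<close> is defined.
\<close>

definition crossing_bound :: "'a measure \<Rightarrow> (nat \<Rightarrow> 'a \<Rightarrow> real) \<Rightarrow> nat \<Rightarrow> nat \<Rightarrow> real" where
  "crossing_bound M X j m =
     2 powr (1 + 1 / real j) * real j * (log (1 + 1 / real j) (2 * real m / 3)) powr (- 1 / real j)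
         / zeta_series (1 + 1 / real j)
     + 262 / min (sd1 M X ^ 4 / (real j)\<^sup>2) 1
         * (real m powr (- 1 / 3) + U2 M X (real m powr (1 / 3)))"

lemma m_index_eq_Least:
  "m_index M X j = (LEAST m. m \<ge> 3 \<and> crossing_bound M X j m \<le> 2 powr (- real j))"
  by (simp add: m_index_def crossing_bound_def)

locale iid_finite_variance = prob_space M for M :: "'a measure" +
  fixes X :: "nat \<Rightarrow> 'a \<Rightarrow> real"
  assumes iid: "iid M X"
    and integrable_X1: "integrable M (X 1)"
    and integrable_X1_sq: "integrable M (\<lambda>\<omega>. (X 1 \<omega>)\<^sup>2)"
    and mean_X1: "expectation (X 1) = 0"
    and variance_X1_pos: "variance (X 1) > 0"
begin

abbreviation "\<sigma> \<equiv> sd1 M X"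

lemma indep_X: "indep_vars (\<lambda>_. borel) X {1..}"
  and distr_X: "1 \<le> i \<Longrightarrow> distr M borel (X i) = distr M borel (X 1)"
  using iid unfolding iid_def by blast+

lemma measurable_X [measurable]: "1 \<le> i \<Longrightarrow> X i \<in> borel_measurable M"
  using indep_X by (auto simp: indep_vars_def)

lemma var1_eq: "var1 M X = expectation (\<lambda>\<omega>. (X 1 \<omega>)\<^sup>2)"
  using mean_X1 by (simp add: var1_def)

lemma sd_pos: "0 < \<sigma>" and sd_sq: "\<sigma>\<^sup>2 = var1 M X"
  using variance_X1_pos by (auto simp: sd1_def var1_def)

lemma distr_comp_X:
  assumes "1 \<le> i" and [measurable]: "g \<in> borel_measurable borel"
  shows "distr M borel (\<lambda>\<omega>. g (X i \<omega>)) = distr M borel (\<lambda>\<omega>. g (X 1 \<omega>))"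
proof -
  have "distr M borel (\<lambda>\<omega>. g (X i \<omega>)) = distr (distr M borel (X i)) borel g" if "1 \<le> i" for i
    using that by (subst distr_distr) (auto simp: comp_def)
  from this[OF assms(1)] this[OF order_refl] distr_X[OF assms(1)] show ?thesis
    by metis
qed

lemma integrable_comp_X:
  fixes g :: "real \<Rightarrow> real"
  assumes "1 \<le> i" and [measurable]: "g \<in> borel_measurable borel"
    and "integrable M (\<lambda>\<omega>. g (X 1 \<omega>))"
  shows "integrable M (\<lambda>\<omega>. g (X i \<omega>))"
    and "expectation (\<lambda>\<omega>. g (X i \<omega>)) = expectation (\<lambda>\<omega>. g (X 1 \<omega>))"
proof -
  have "integrable (distr M borel (X i)) g \<longleftrightarrow> integrable M (\<lambda>\<omega>. g (X i \<omega>))"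
    and "expectation (\<lambda>\<omega>. g (X i \<omega>)) = (\<integral>x. g x \<partial>distr M borel (X i))" if "1 \<le> i" for i
    using that by (auto simp: integrable_distr_eq integral_distr)
  with assms(1,3) distr_X[OF assms(1)] order_refl[of "1::nat"]
  show "integrable M (\<lambda>\<omega>. g (X i \<omega>))"
    and "expectation (\<lambda>\<omega>. g (X i \<omega>)) = expectation (\<lambda>\<omega>. g (X 1 \<omega>))"
    by metis+
qed

lemma measurable_partial_sum [measurable]: "partial_sum X k \<in> borel_measurable M"
  unfolding partial_sum_def by measurable

lemma measurable_crossing [measurable]: "Measurable.pred M (crossing M X j k)"
  unfolding crossing_def by measurable

lemma U2_nonneg: "0 \<le> U2 M X x"
  unfolding U2_def by (rule Bochner_Integration.integral_nonneg) simp

lemma quadratic_variation_deviation: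
  assumes "0 < d" "0 < x" "1 \<le> m"
  shows "prob {\<omega> \<in> space M. \<exists>k\<ge>m. real k * d < (\<Sum>i=1..k. (X i \<omega>)\<^sup>2 - \<sigma>\<^sup>2)}
    \<le> exp (- (real m * d\<^sup>2 / (18 * x\<^sup>2))) + 3 * U2 M X x / d"
  unfolding U2_def sd_sq[symmetric]
proof (rule iid_average_upper_deviation)
  show "indep_vars (\<lambda>_. borel) (\<lambda>i \<omega>. (X i \<omega>)\<^sup>2 - \<sigma>\<^sup>2) {1..}"
    by (rule indep_vars_compose2[OF indep_X]) measurable
  show "distr M borel (\<lambda>\<omega>. (X i \<omega>)\<^sup>2 - \<sigma>\<^sup>2) = distr M borel (\<lambda>\<omega>. (X 1 \<omega>)\<^sup>2 - \<sigma>\<^sup>2)" if "1 \<le> i" for i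
    using that by (rule distr_comp_X) measurable
  show "integrable M (\<lambda>\<omega>. (X 1 \<omega>)\<^sup>2 - \<sigma>\<^sup>2)" using integrable_X1_sq by simp
  show "expectation (\<lambda>\<omega>. (X 1 \<omega>)\<^sup>2 - \<sigma>\<^sup>2) = 0"
    using integrable_X1_sq by (simp add: sd_sq var1_eq prob_space)
qed fact+

text \<open>
  A crossing at a time \<open>k \<ge> m\<close> either happens while \<open>W k \<le> (1 + \<epsilon>) * k\<close>, and is then a crossing
  of the stitched boundary, or forces the average of the \<open>X\<^sup>2 - \<sigma>\<^sup>2\<close> above
  \<open>3 * \<epsilon> * \<sigma>\<^sup>2\<close>; the factor \<open>3\<close> arises because the squares enter the clock with weight
  \<open>1 / 3\<close>.
\<close>

lemma prob_crossing_le: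
  assumes j: "1 \<le> j" and m: "3 \<le> m"
  shows "prob {\<omega> \<in> space M. \<exists>k\<ge>m. crossing M X j k \<omega>} \<le> crossing_bound M X j m"
proof -
  define \<epsilon> where "\<epsilon> = 1 / real j"
  have e: "0 < \<epsilon>" "\<epsilon> \<le> 1" using j by (auto simp: \<epsilon>_def)
  define L where "L = log (1 + \<epsilon>) (2 * real m / 3)"
  define i0 where "i0 = nat \<lfloor>L\<rfloor>"
  (* 1 + \<epsilon> \<le> 2 \<le> 2 * m / 3 since m \<ge> 3; hence rounding L down costs at most a factor 2. *)
  have L1: "1 \<le> L" unfolding L_def using e m by (simp add: le_log_iff)
  have i0: "1 \<le> i0" "real i0 \<le> L" "L / 2 \<le> real i0"
  proof -
    have "1 \<le> \<lfloor>L\<rfloor>" using L1 by (simp add: le_floor_iff)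
    then have "real i0 = of_int \<lfloor>L\<rfloor>" "1 \<le> real_of_int \<lfloor>L\<rfloor>" by (auto simp: i0_def)
    with of_int_floor_le[of L] floor_correct[of L]
    show "1 \<le> i0" "real i0 \<le> L" "L / 2 \<le> real i0" by linarith+
  qed
  have pow_i0: "(1 + \<epsilon>) powr real i0 \<le> 2 * real m / 3"
    using i0(2) e m unfolding L_def by (simp add: le_log_iff)
  define d where "d = 3 * \<epsilon> * \<sigma>\<^sup>2"
  have d: "0 < d" using e sd_pos by (simp add: d_def)
  define x where "x = real m powr (1 / 3)"
  have x: "0 < x" using m by (simp add: x_def)
  define R where "R i \<omega> = X i \<omega> / \<sigma>" for i \<omega>
  define W where "W k \<omega> = (\<Sum>i=1..k. ((R i \<omega>)\<^sup>2 + 2) / 3)" for k \<omega>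
  have [measurable]: "R i \<in> borel_measurable M" if "1 \<le> i" for i
    using that unfolding R_def by measurable
  have [measurable]: "W k \<in> borel_measurable M" for k
    unfolding W_def by measurable
  define c where "c k = c_const \<epsilon> * sqrt (real k * (ln (ln ((1 + \<epsilon>)\<^sup>2 * real k)) + l_const \<epsilon>))" for k
  let ?E = "{\<omega> \<in> space M. \<exists>k\<ge>m. crossing M X j k \<omega>}"
  let ?G = "{\<omega> \<in> space M. \<exists>k\<ge>m. real k * d < (\<Sum>i=1..k. (X i \<omega>)\<^sup>2 - \<sigma>\<^sup>2)}"
  let ?H = "{\<omega> \<in> space M. \<exists>k. (1 + \<epsilon>) powr real i0 \<le> W k \<omega> \<and> W k \<omega> \<le> (1 + \<epsilon>) * real k \<and>
      c k \<le> \<bar>\<Sum>i=1..k. R i \<omega>\<bar>}"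
  have "prob ?E \<le> prob (?G \<union> ?H)"
  proof (rule finite_measure_mono)
    show "?E \<subseteq> ?G \<union> ?H"
    proof safe
      fix \<omega> k
      assume \<omega>: "\<omega> \<in> space M" and k: "m \<le> k" and cross: "crossing M X j k \<omega>"
        and no: "\<not> (\<exists>k. (1 + \<epsilon>) powr real i0 \<le> W k \<omega> \<and> W k \<omega> \<le> (1 + \<epsilon>) * real k \<and>
          c k \<le> \<bar>\<Sum>i=1..k. R i \<omega>\<bar>)"
      have sumR: "(\<Sum>i=1..k. R i \<omega>) = partial_sum X k \<omega> / \<sigma>"
        by (simp add: R_def partial_sum_def sum_divide_distrib)
      have quot: "1 \<le> \<bar>\<Sum>i=1..k. R i \<omega>\<bar> / c k"
        using cross unfolding crossing_def sumR c_def \<epsilon>_def .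
      (* A nonpositive denominator would make the quotient at most 0, as division by 0 gives 0. *)
      then have "0 < c k"
        by (metis abs_ge_zero divide_nonneg_nonpos not_le not_one_le_zero order_trans)
      with quot have ck: "c k \<le> \<bar>\<Sum>i=1..k. R i \<omega>\<bar>"
        by (simp add: pos_le_divide_eq)
      have W_eq: "W k \<omega> = (\<Sum>i=1..k. (R i \<omega>)\<^sup>2) / 3 + 2 * real k / 3"
        by (simp add: W_def sum_divide_distrib[symmetric] sum.distrib)
      have "2 * real m / 3 \<le> W k \<omega>"
        unfolding W_eq using k by (intro add_increasing) (auto intro!: divide_nonneg_pos sum_nonneg)
      with pow_i0 have "(1 + \<epsilon>) powr real i0 \<le> W k \<omega>" by simp
      with no ck have "(1 + \<epsilon>) * real k < W k \<omega>" by force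
      then have "real k + 3 * \<epsilon> * real k < (\<Sum>i=1..k. (R i \<omega>)\<^sup>2)"
        by (simp add: W_eq field_simps)
      also have "\<dots> = (\<Sum>i=1..k. (X i \<omega>)\<^sup>2) / \<sigma>\<^sup>2"
        by (simp add: R_def power_divide sum_divide_distrib)
      finally have "real k * d < (\<Sum>i=1..k. (X i \<omega>)\<^sup>2) - real k * \<sigma>\<^sup>2"
        using sd_pos by (simp add: d_def pos_less_divide_eq algebra_simps)
      then show "\<exists>k\<ge>m. real k * d < (\<Sum>i=1..k. (X i \<omega>)\<^sup>2 - \<sigma>\<^sup>2)"
        using k by (auto simp: sum_subtractf)
    qed
  qed measurable
  also have "\<dots> \<le> prob ?G + prob ?H"
    by (rule measure_Un_le) measurable
  also have "prob ?H \<le> real i0 powr (- \<epsilon>) / (\<epsilon> * zeta_series (1 + \<epsilon>))"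
    unfolding W_def c_def
  proof (rule stitched_boundary_crossing)
    show "indep_vars (\<lambda>_. borel) R {1..}"
      unfolding R_def by (rule indep_vars_compose2[OF indep_X]) measurable
    fix i :: nat assume i: "1 \<le> i"
    show "integrable M (R i)" "integrable M (\<lambda>\<omega>. (R i \<omega>)\<^sup>2)"
      using integrable_comp_X(1)[OF i, of "\<lambda>x. x"] integrable_comp_X(1)[OF i, of "\<lambda>x. x\<^sup>2"]
        integrable_X1 integrable_X1_sq by (auto simp: R_def[abs_def] power_divide)
    show "expectation (R i) = 0"
      using integrable_comp_X(2)[OF i, of "\<lambda>x. x"] integrable_X1 mean_X1 by (simp add: R_def[abs_def])
    have "expectation (\<lambda>\<omega>. (X i \<omega>)\<^sup>2) = \<sigma>\<^sup>2"
      using integrable_comp_X(2)[OF i, of "\<lambda>x. x\<^sup>2"] integrable_X1_sq by (simp add: sd_sq var1_eq)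
    then show "expectation (\<lambda>\<omega>. (R i \<omega>)\<^sup>2) = 1"
      using sd_pos by (simp add: R_def power_divide)
  qed fact+
  also have "\<dots> \<le> 2 powr (1 + \<epsilon>) * real j * L powr (- \<epsilon>) / zeta_series (1 + \<epsilon>)"
  proof -
    have "real i0 powr (- \<epsilon>) \<le> (L / 2) powr (- \<epsilon>)"
      using i0 L1 e by (intro powr_mono2') auto
    also have "\<dots> = 2 powr \<epsilon> * L powr (- \<epsilon>)"
      using L1 by (simp add: powr_divide powr_minus divide_simps)
    also have "\<dots> \<le> 2 powr (1 + \<epsilon>) * L powr (- \<epsilon>)"
      by (intro mult_right_mono) auto
    finally have "real i0 powr (- \<epsilon>) * real j \<le> 2 powr (1 + \<epsilon>) * L powr (- \<epsilon>) * real j"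
      by (rule mult_right_mono) simp
    then have "real i0 powr (- \<epsilon>) * real j / zeta_series (1 + \<epsilon>)
        \<le> 2 powr (1 + \<epsilon>) * L powr (- \<epsilon>) * real j / zeta_series (1 + \<epsilon>)"
      using zeta_series_ge_1[of "1 + \<epsilon>"] e by (intro divide_right_mono) auto
    then show ?thesis by (simp add: \<epsilon>_def mult_ac)
  qed
  also have "prob ?G \<le> exp (- (real m * d\<^sup>2 / (18 * x\<^sup>2))) + 3 * U2 M X x / d"
    using d x m by (intro quadratic_variation_deviation) auto
  also have "\<dots> \<le> 262 / min (\<sigma> ^ 4 / (real j)\<^sup>2) 1 * (real m powr (- 1 / 3) + U2 M X x)"
  proof -
    define w where "w = \<sigma>\<^sup>2 / real j"
    have w: "0 < w" using sd_pos j by (simp add: w_def)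
    have w2: "\<sigma> ^ 4 / (real j)\<^sup>2 = w\<^sup>2"
      by (simp add: w_def power_divide power2_eq_square power4_eq_xxxx)
    define \<mu> where "\<mu> = min (w\<^sup>2) 1"
    have mu: "0 < \<mu>" "\<mu> \<le> w\<^sup>2" "\<mu> \<le> w"
    proof -
      show "\<mu> \<le> w"
      proof (cases "w \<le> 1")
        case True
        then have "w\<^sup>2 \<le> w" using w by (simp add: power2_eq_square mult_left_le)
        then show ?thesis by (simp add: \<mu>_def)
      qed (simp add: \<mu>_def)
    qed (use w in \<open>auto simp: \<mu>_def\<close>)
    have dw: "d = 3 * w" by (simp add: d_def w_def \<epsilon>_def)
    have mx: "real m / x\<^sup>2 = real m powr (1 / 3)"
    proof -
      have "x\<^sup>2 * real m powr (1 / 3) = real m powr 1"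
        by (simp add: x_def power2_eq_square powr_add[symmetric])
      then show ?thesis using x m by (simp add: field_simps)
    qed
    (* exp (- u) \<le> 1 / u turns the exponential bound into the power m powr (- 1 / 3). *)
    define u where "u = real m powr (1 / 3) * w\<^sup>2 / 2"
    have u: "0 < u" using m w by (simp add: u_def)
    have "real m * d\<^sup>2 / (18 * x\<^sup>2) = real m / x\<^sup>2 * (w\<^sup>2 / 2)"
      by (simp add: dw power_mult_distrib)
    also have "\<dots> = u" by (simp add: mx u_def)
    finally have "exp (- (real m * d\<^sup>2 / (18 * x\<^sup>2))) = 1 / exp u" by (simp add: exp_minus field_simps)
    also have "u \<le> exp u" using exp_ge_add_one_self[of u] by linarith
    then have "1 / exp u \<le> 1 / u" using u by (intro divide_left_mono) auto
    also have "\<dots> = 2 / w\<^sup>2 * real m powr (- 1 / 3)"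
      using m w by (simp add: u_def powr_minus_divide field_simps)
    also have "\<dots> \<le> 262 / \<mu> * real m powr (- 1 / 3)"
      using mu w by (intro mult_right_mono frac_le) auto
    finally have 1: "exp (- (real m * d\<^sup>2 / (18 * x\<^sup>2))) \<le> 262 / \<mu> * real m powr (- 1 / 3)" .
    have "3 * U2 M X x / d = 1 / w * U2 M X x" by (simp add: dw)
    also have "\<dots> \<le> 262 / \<mu> * U2 M X x"
      using mu w U2_nonneg by (intro mult_right_mono frac_le) auto
    finally have 2: "3 * U2 M X x / d \<le> 262 / \<mu> * U2 M X x" .
    from add_mono[OF 1 2] show ?thesis
      by (simp add: w2 \<mu>_def distrib_left)
  qed
  finally show ?thesis
    by (simp add: crossing_bound_def L_def x_def \<epsilon>_def)
qed

section \<open>The starting times of the boundaries\<close>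

lemma U2_tendsto_0:
  assumes "filterlim x at_top sequentially"
  shows "(\<lambda>n. U2 M X (x n)) \<longlonglongrightarrow> 0"
proof -
  let ?Y = "\<lambda>\<omega>. \<bar>(X 1 \<omega>)\<^sup>2 - var1 M X\<bar>"
  have "(\<lambda>n. expectation (\<lambda>\<omega>. ?Y \<omega> * of_bool (x n \<le> ?Y \<omega>))) \<longlonglongrightarrow> expectation (\<lambda>_. 0)"
  proof (rule integral_dominated_convergence)
    show "integrable M ?Y" using integrable_X1_sq by simp
    show "AE \<omega> in M. (\<lambda>n. ?Y \<omega> * of_bool (x n \<le> ?Y \<omega>)) \<longlonglongrightarrow> 0"
    proof (rule AE_I2)
      fix \<omega>
      from assms have "\<forall>\<^sub>F n in sequentially. ?Y \<omega> < x n"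
        by (auto simp: filterlim_at_top_dense)
      then show "(\<lambda>n. ?Y \<omega> * of_bool (x n \<le> ?Y \<omega>)) \<longlonglongrightarrow> 0"
        by (intro tendsto_eventually) (elim eventually_mono, simp)
    qed
  qed auto
  then show ?thesis by (simp add: U2_def)
qed

lemma crossing_bound_tendsto_0:
  assumes "1 \<le> j"
  shows "crossing_bound M X j \<longlonglongrightarrow> 0"
proof -
  define b where "b = 1 + 1 / real j"
  have b: "1 < b" using assms by (simp add: b_def)
  have 1: "(\<lambda>m. log b (2 * real m / 3) powr (- 1 / real j)) \<longlonglongrightarrow> 0"
  proof (rule tendsto_neg_powr)
    have "0 < ln b" using b by simp
    then show "filterlim (\<lambda>m. log b (2 * real m / 3)) at_top sequentially"
      unfolding log_def by real_asymp
  qed (use assms in simp)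
  have 2: "(\<lambda>m. real m powr (- 1 / 3)) \<longlonglongrightarrow> 0" by real_asymp
  have "filterlim (\<lambda>m. real m powr (1 / 3)) at_top sequentially" by real_asymp
  from U2_tendsto_0[OF this] have 3: "(\<lambda>m. U2 M X (real m powr (1 / 3))) \<longlonglongrightarrow> 0" .
  have "crossing_bound M X j \<longlonglongrightarrow>
      2 powr (1 + 1 / real j) * real j * 0 / zeta_series b
      + 262 / min (\<sigma> ^ 4 / (real j)\<^sup>2) 1 * (0 + 0)"
    unfolding crossing_bound_def[abs_def] b_def[symmetric]
    by (intro tendsto_intros 1 2 3) (use zeta_series_ge_1[OF b] in simp)
  then show ?thesis by simp
qed

text \<open>
  The set over which \<^const>\<open>m_index\<close> takes a least element is nonempty because the bound tends to
  \<open>0\<close>, by dominated convergence in the case of \<^const>\<open>U2\<close>.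
\<close>

lemma m_index_properties:
  assumes "1 \<le> j"
  shows "3 \<le> m_index M X j" and "crossing_bound M X j (m_index M X j) \<le> 2 powr (- real j)"
proof -
  have "\<forall>\<^sub>F m in sequentially. crossing_bound M X j m < 2 powr (- real j)"
    by (rule order_tendstoD(2)[OF crossing_bound_tendsto_0[OF assms]]) simp
  then have "\<forall>\<^sub>F m in sequentially. m \<ge> 3 \<and> crossing_bound M X j m \<le> 2 powr (- real j)"
    using eventually_ge_at_top[of "3::nat"] by eventually_elim simp
  then obtain m where "m \<ge> 3 \<and> crossing_bound M X j m \<le> 2 powr (- real j)"
    by (auto simp: eventually_at_top_linorder)
  from LeastI[of "\<lambda>m. m \<ge> 3 \<and> crossing_bound M X j m \<le> 2 powr (- real j)", OF this]
  show "3 \<le> m_index M X j" and "crossing_bound M X j (m_index M X j) \<le> 2 powr (- real j)"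
    unfolding m_index_eq_Least by auto
qed

text \<open>
  Already the summand \<open>m powr (- 1 / 3)\<close>, whose coefficient is at least \<open>1\<close>, forces
  \<open>m \<ge> 2 ^ (3 * j)\<close>. This makes the sum defining \<^const>\<open>E2\<close> finite at each time.
\<close>

lemma m_index_gt:
  assumes j: "1 \<le> j"
  shows "j < m_index M X j"
proof -
  define m where "m = m_index M X j"
  have m: "3 \<le> m" "crossing_bound M X j m \<le> 2 powr (- real j)"
    using m_index_properties[OF j] by (simp_all add: m_def)
  have mu: "0 < min (\<sigma> ^ 4 / (real j)\<^sup>2) 1" "min (\<sigma> ^ 4 / (real j)\<^sup>2) 1 \<le> 1"
    using sd_pos j by auto
  have "1 \<le> 262 / min (\<sigma> ^ 4 / (real j)\<^sup>2) 1"
    using mu by (simp add: pos_le_divide_eq del: min_less_iff_conj min_le_iff_disj)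
  then have "1 * (real m powr (- 1 / 3) + 0)
      \<le> 262 / min (\<sigma> ^ 4 / (real j)\<^sup>2) 1 * (real m powr (- 1 / 3) + U2 M X (real m powr (1 / 3)))"
    using U2_nonneg by (intro mult_mono add_left_mono) auto
  also have "\<dots> \<le> crossing_bound M X j m"
    unfolding crossing_bound_def using zeta_series_ge_1[of "1 + 1 / real j"] j
    by (simp add: divide_nonneg_pos)
  also have "\<dots> \<le> 2 powr (- real j)" by fact
  finally have le: "real m powr (- 1 / 3) \<le> 2 powr (- real j)" by simp
  have "real j < 2 ^ j" by (rule of_nat_less_two_power)
  also have "(2::real) ^ j = 2 powr real j" by (simp add: powr_realpow)
  also have "\<dots> \<le> real m powr (1 / 3)"
    using le m by (simp add: powr_minus_divide divide_simps split: if_splits)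
  also have "\<dots> \<le> real m powr 1" using m by (intro powr_mono) auto
  also have "\<dots> = real m" using m by simp
  finally show ?thesis by (simp add: m_def)
qed

section \<open>The e-process property\<close>

lemma E2_eq_sum:
  "E2 M X n \<omega> = (\<Sum>j=1..n. of_bool (\<exists>k\<in>{m_index M X j..n}. crossing M X j k \<omega>))"
proof (cases "n = 0")
  case False
  have "(\<Sum>\<^sub>\<infinity>j\<in>{1..}. of_bool (\<exists>k\<in>{m_index M X j..n}. crossing M X j k \<omega>) :: ennreal)
      = (\<Sum>\<^sub>\<infinity>j\<in>{1..n}. of_bool (\<exists>k\<in>{m_index M X j..n}. crossing M X j k \<omega>))"
  proof (rule infsum_cong_neutral)
    fix j assume "j \<in> {1..} - {1..n}"
    then have "n < m_index M X j" using m_index_gt[of j] by auto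
    then show "of_bool (\<exists>k\<in>{m_index M X j..n}. crossing M X j k \<omega>) = (0 :: ennreal)"
      by auto
  qed auto
  with False show ?thesis by (simp add: E2_def)
qed (simp add: E2_def)

lemma E2_le_suminf:
  "E2 M X n \<omega> \<le> (\<Sum>j. of_bool (\<exists>k\<ge>m_index M X (Suc j). crossing M X (Suc j) k \<omega>))"
proof -
  have "E2 M X n \<omega> = (\<Sum>j<n. of_bool (\<exists>k\<in>{m_index M X (Suc j)..n}. crossing M X (Suc j) k \<omega>))"
    unfolding E2_eq_sum by (simp only: One_nat_def sum.atLeast1_atMost_eq)
  also have "\<dots> \<le> (\<Sum>j<n. of_bool (\<exists>k\<ge>m_index M X (Suc j). crossing M X (Suc j) k \<omega>))"
    by (intro sum_mono) auto
  also have "\<dots> \<le> (\<Sum>j. of_bool (\<exists>k\<ge>m_index M X (Suc j). crossing M X (Suc j) k \<omega>))"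
    by (rule sum_le_suminf) auto
  finally show ?thesis .
qed

text \<open>
  The process is dominated, uniformly in time, by the number of boundaries that are ever crossed;
  hence the integral is at most the expectation of that number, whatever \<open>\<tau>\<close> is.
\<close>

lemma nn_integral_stopped_E2_le:
  "(\<integral>\<^sup>+\<omega>. stopped (E2 M X) \<tau> \<omega> \<partial>M) \<le> 1"
proof -
  let ?hit = "\<lambda>j. {\<omega> \<in> space M. \<exists>k\<ge>m_index M X j. crossing M X j k \<omega>}"
  have "(\<integral>\<^sup>+\<omega>. stopped (E2 M X) \<tau> \<omega> \<partial>M)
      \<le> (\<integral>\<^sup>+\<omega>. (\<Sum>j. indicator (?hit (Suc j)) \<omega>) \<partial>M)"
  proof (rule nn_integral_mono)
    fix \<omega> assume \<omega>: "\<omega> \<in> space M"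
    have "(\<Sum>j. indicator (?hit (Suc j)) \<omega>)
        = (\<Sum>j. of_bool (\<exists>k\<ge>m_index M X (Suc j). crossing M X (Suc j) k \<omega>) :: ennreal)"
      using \<omega> by (intro suminf_cong) (simp add: indicator_def)
    moreover have "limsup (\<lambda>n. E2 M X n \<omega>)
        \<le> (\<Sum>j. of_bool (\<exists>k\<ge>m_index M X (Suc j). crossing M X (Suc j) k \<omega>))"
      by (intro Limsup_bounded always_eventually allI E2_le_suminf)
    ultimately show "stopped (E2 M X) \<tau> \<omega> \<le> (\<Sum>j. indicator (?hit (Suc j)) \<omega>)"
      using E2_le_suminf by (simp add: stopped_def split: enat.split)
  qed
  also have "\<dots> = (\<Sum>j. emeasure M (?hit (Suc j)))"
    by (subst nn_integral_suminf) auto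
  also have "\<dots> \<le> (\<Sum>j. ennreal ((1 / 2) ^ Suc j))"
  proof (intro suminf_le)
    fix j
    have "prob (?hit (Suc j)) \<le> crossing_bound M X (Suc j) (m_index M X (Suc j))"
      using m_index_properties[of "Suc j"] by (intro prob_crossing_le) auto
    also have "\<dots> \<le> 2 powr (- real (Suc j))" by (rule m_index_properties) simp
    also have "\<dots> = (1 / 2) ^ Suc j"
      by (simp only: powr_minus powr_realpow zero_less_numeral power_one_over inverse_eq_divide)
    finally show "emeasure M (?hit (Suc j)) \<le> ennreal ((1 / 2) ^ Suc j)"
      unfolding emeasure_eq_measure by (rule ennreal_leI)
  qed auto
  also have "\<dots> = 1"
    by (subst suminf_ennreal_eq[OF _ power_half_series]) simp_all
  finally show ?thesis .
qed

lemma space_generated_filtration [simp]: "space (generated_filtration M X n) = space M"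
  by (simp add: generated_filtration_def space_measure_of_conv)

lemma sets_generated_filtration:
  "sets (generated_filtration M X n) =
     sigma_sets (space M) {X i -` B \<inter> space M | i B. i \<in> {1..n} \<and> B \<in> sets borel}"
  unfolding generated_filtration_def by (rule sets_measure_of) auto

lemma filtration_generated: "filtration (space M) (generated_filtration M X)"
proof
  fix i j :: nat assume "i \<le> j"
  then show "sets (generated_filtration M X i) \<subseteq> sets (generated_filtration M X j)"
    unfolding sets_generated_filtration by (intro sigma_sets_mono') fastforce
qed simp

lemma subalgebra_generated: "subalgebra M (generated_filtration M X n)"
proof -
  have "{X i -` B \<inter> space M | i B. i \<in> {1..n} \<and> B \<in> sets borel} \<subseteq> events"
    by (auto intro: measurable_sets[OF measurable_X])
  then show ?thesis
    unfolding subalgebra_def sets_generated_filtration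
    by (intro conjI space_generated_filtration sets.sigma_sets_subset)
qed

lemma measurable_X_filtration:
  assumes "i \<in> {1..n}"
  shows "X i \<in> borel_measurable (generated_filtration M X n)"
  using assms by (intro measurableI) (auto simp: sets_generated_filtration intro!: sigma_sets.Basic)

lemma measurable_E2: "E2 M X n \<in> borel_measurable (generated_filtration M X n)"
proof -
  have S: "partial_sum X k \<in> borel_measurable (generated_filtration M X n)" if "k \<le> n" for k
    unfolding partial_sum_def
    by (rule borel_measurable_sum) (use that in \<open>auto intro!: measurable_X_filtration\<close>)
  have "Measurable.pred (generated_filtration M X n) (crossing M X j k)" if "k \<in> {a..n}" for a j k
  proof -
    have [measurable]: "partial_sum X k \<in> borel_measurable (generated_filtration M X n)"
      using that by (intro S) simp
    show ?thesis unfolding crossing_def by measurable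
  qed
  then have [measurable]: "Measurable.pred (generated_filtration M X n)
      (\<lambda>\<omega>. \<exists>k\<in>{m_index M X j..n}. crossing M X j k \<omega>)" for j
    by (intro pred_intros_finite) auto
  show ?thesis unfolding E2_eq_sum[abs_def] by measurable
qed

lemma e_process_E2: "e_process M (generated_filtration M X) (E2 M X)"
  unfolding e_process_def
proof (intro conjI allI ballI impI)
  show "E2 M X n \<omega> < \<infinity>" for n \<omega>
    unfolding E2_eq_sum by (auto simp: less_top[symmetric])
qed (use filtration_generated subalgebra_generated measurable_E2 nn_integral_stopped_E2_le in auto)

section \<open>Divergence under large fluctuations\<close>

text \<open>
  Choose \<open>q\<close> strictly between \<open>1\<close> and the upper limit. All but finitely many boundaries have
  \<open>c_const (1 / j) < q * sqrt 2\<close>, and each of these lies eventually below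
  \<open>q * sqrt (2 * k * ln (ln k))\<close>, which the walk exceeds infinitely often. Any \<open>N\<close> of them are
  therefore crossed by some finite time.
\<close>

lemma E2_tendsto_infinity:
  assumes "\<omega> \<in> A_fluc M X"
  shows "(\<lambda>n. E2 M X n \<omega>) \<longlonglongrightarrow> \<infinity>"
proof -
  let ?f = "\<lambda>n. \<bar>partial_sum X n \<omega> / \<sigma>\<bar> / sqrt (2 * real n * ln (ln (real n)))"
  from assms have "1 < limsup (\<lambda>n. ereal (?f n))" by (simp add: A_fluc_def)
  then obtain q where q: "1 < ereal q" "ereal q < limsup (\<lambda>n. ereal (?f n))"
    using ereal_dense2 by blast
  have freq: "\<exists>\<^sub>F n in sequentially. q < ?f n"
  proof (rule ccontr)
    assume "\<not> (\<exists>\<^sub>F n in sequentially. q < ?f n)"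
    then have "\<forall>\<^sub>F n in sequentially. ereal (?f n) \<le> ereal q"
      by (simp add: not_frequently not_less)
    then have "limsup (\<lambda>n. ereal (?f n)) \<le> ereal q"
      by (rule Limsup_bounded)
    with q(2) show False by simp
  qed
  have "\<forall>\<^sub>F j in sequentially. c_const (1 / real j) < q * sqrt 2"
    using q(1) by (intro order_tendstoD(2)[OF c_const_tendsto]) (simp add: one_ereal_def)
  then obtain J where J: "\<And>j. J \<le> j \<Longrightarrow> c_const (1 / real j) < q * sqrt 2"
    by (auto simp: eventually_at_top_linorder)
  have cross: "\<exists>k\<ge>m_index M X j. crossing M X j k \<omega>" if "max 1 J \<le> j" for j
  proof -
    define c where "c = c_const (1 / real j)"
    define B where "B k = c * sqrt (real k * (ln (ln ((1 + 1 / real j)\<^sup>2 * real k)) + l_const (1 / real j)))" for k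
    have "0 < 1 + 1 / real j" by (intro add_pos_nonneg) auto
    then have c: "0 < c" "c < q * sqrt 2"
      using J[of j] that by (auto simp: c_def c_const_def intro!: divide_pos_pos add_pos_pos)
    have "\<forall>\<^sub>F k in sequentially. 0 < ln (ln (real k)) \<and> 0 < B k \<and> B k \<le> q * sqrt (2 * real k * ln (ln (real k)))"
      unfolding B_def using c by (intro boundary_eventually_less) (auto simp: one_le_power)
    then have "\<forall>\<^sub>F k in sequentially. 0 < ln (ln (real k)) \<and> 0 < B k \<and>
        B k \<le> q * sqrt (2 * real k * ln (ln (real k))) \<and> max 1 (m_index M X j) \<le> k"
      using eventually_ge_at_top[of "max 1 (m_index M X j)"] by eventually_elim simp
    from frequently_ex[OF frequently_eventually_frequently[OF freq this]]
    obtain k where k: "q < ?f k" "0 < ln (ln (real k))" "0 < B k"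
        "B k \<le> q * sqrt (2 * real k * ln (ln (real k)))" "max 1 (m_index M X j) \<le> k"
      by blast
    have "q * sqrt (2 * real k * ln (ln (real k))) < \<bar>partial_sum X k \<omega> / \<sigma>\<bar>"
      using k by (subst (asm) pos_less_divide_eq) auto
    with k(4) have "B k \<le> \<bar>partial_sum X k \<omega> / \<sigma>\<bar>" by linarith
    then have "1 \<le> \<bar>partial_sum X k \<omega> / \<sigma>\<bar> / B k"
      by (subst pos_le_divide_eq[OF k(3)]) simp
    then have "crossing M X j k \<omega>"
      unfolding crossing_def B_def c_def .
    with k(5) show ?thesis by auto
  qed
  show ?thesis
  proof (rule order_tendstoI)
    fix a :: ennreal assume "a < \<infinity>"
    then obtain N where N: "a < of_nat N"
      using ennreal_Ex_less_of_nat by auto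
    define I where "I = {max 1 J..<max 1 J + N}"
    have "\<forall>j\<in>I. \<exists>k\<ge>m_index M X j. crossing M X j k \<omega>"
      using cross by (auto simp: I_def)
    then obtain \<kappa> where kap: "\<And>j. j \<in> I \<Longrightarrow> m_index M X j \<le> \<kappa> j \<and> crossing M X j (\<kappa> j) \<omega>"
      by metis
    have "\<forall>\<^sub>F n in sequentially. max (max 1 J + N) (Max (insert 0 (\<kappa> ` I))) \<le> n"
      by (rule eventually_ge_at_top)
    then show "\<forall>\<^sub>F n in sequentially. a < E2 M X n \<omega>"
    proof eventually_elim
      case (elim n)
      have le: "\<kappa> j \<le> n" if "j \<in> I" for j
        using elim that by (auto simp: I_def)
      have "of_nat N = (\<Sum>j\<in>I. 1 :: ennreal)" by (simp add: I_def)
      also have "\<dots> = (\<Sum>j\<in>I. of_bool (\<exists>k\<in>{m_index M X j..n}. crossing M X j k \<omega>))"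
        using kap le by (intro sum.cong refl) fastforce
      also have "\<dots> \<le> E2 M X n \<omega>"
        unfolding E2_eq_sum using elim by (intro sum_mono2) (auto simp: I_def)
      finally show ?case using N by simp
    qed
  qed auto
qed

end

theorem mainTheorem12:
  fixes M :: "'a measure" and X :: "nat \<Rightarrow> 'a \<Rightarrow> real"
  assumes "prob_space M"
    and "iid M X"
    and "integrable M (X 1)"
    and "integrable M (\<lambda>\<omega>. (X 1 \<omega>)\<^sup>2)"
    and "prob_space.expectation M (X 1) = 0"
    and "prob_space.variance M (X 1) > 0"
  shows "e_process M (generated_filtration M X) (E2 M X) \<and>
    (\<forall>\<omega>\<in>A_fluc M X. (\<lambda>n. E2 M X n \<omega>) \<longlonglongrightarrow> \<infinity>)"
proof -
  interpret prob_space M by fact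
  interpret iid_finite_variance M X
    using assms by unfold_locales
  show ?thesis using e_process_E2 E2_tendsto_infinity by blast
qed

end
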